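(* Let $\lambda>0$, $s\in\mathbb R$, $y_1\ge y_0>0$ and $l\in\mathbb N$ with $l\ge2$. Let $g:(0,\infty)\to\mathbb R$ be of class $\mathcal C^2$. (1) If $|g'|\ge\lambda$ and $g''$ has a finite number of zeros on $(0,y_0]$, there exists $C>0$ such that for any $t\in\mathbb R\setminus\{0\}$, any $\delta>0$ and any $k\in\mathbb Z$ with $2^k\le\frac12y_0$, $$\sup_{x\in\mathbb R^2}|I^{s}_{t,x,k}|\le C\,\frac{2^{(s+2-\frac1l)k}\delta^{-(s+2-\frac1l)}}{|t|^{\frac1l}}.$$ (2) If $g$ is $\mathcal C^l$, $\sum_{p=1}^{l}|g^{(p)}|\ge\lambda$ and $g''$ has a finite number of zeros on $[\frac12y_0,2y_1]$, there exists $C>0$ such that for any $t\in\mathbb R\setminus\{0\}$, any $\delta>0$ and any $k\in\mathbb Z$ with $y_0\le2^k\le y_1$, $$\sup_{x\in\mathbb R^2}|I^{s}_{t,x,k}|\le C\,\frac{\delta^{-(s+2-\frac1l)}}{|t|^{\frac1l}},\qquad \sup_{x\in\mathbb R^2}\Big|\int_{\mathbb R^2}e^{ix\cdot\xi}e^{i\frac t\delta g(\delta|\xi|)}\sum_{y_0\le2^k\le y_1}Q_k(\delta|\xi|)|\xi|^{s}d\xi\Big|\le C\,\frac{\delta^{-(s+2-\frac1l)}}{|t|^{\frac1l}}.$$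
   Context: Dimension $n=2$. $P$ is a fixed smooth even function on $\mathbb R$ supported in $[-2,-\tfrac12]\cup[\tfrac12,2]$, and for $t\in\mathbb R$, $x\in\mathbb R^2$, $s\in\mathbb R$, $k\in\mathbb Z$, $\delta>0$, $$I^{s}_{t,x,k}:=\int_{\mathbb R^2}e^{ix\cdot\xi}e^{i\frac t\delta g(\delta|\xi|)}P\big(\tfrac{\delta|\xi|}{2^k}\big)|\xi|^{s}\,d\xi.$$ Littlewood-Paley functions: $\varphi_0$ is a fixed smooth nonnegative even function supported in $[-\tfrac45,\tfrac45]$, equal to $1$ on $[-\tfrac35,\tfrac35]$ and nonincreasing on $[0,\infty)$; $Q_j(y):=\varphi_0(2^{-j-1}y)-\varphi_0(2^{-j}y)$. Sums are over $k\in\mathbb Z$ with the indicated condition. Constants $C$ do not depend on $t,\delta,k,x$. *)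

theory Defs
  imports "HOL-Analysis.Analysis"
begin

text \<open>Class \<open>C\<^sup>n\<close> of a function of one real variable. It is meant for open \<open>S\<close>, since derivatives
  are taken at \<open>x\<close> and not merely within \<open>S\<close>; the values of \<open>f\<close> outside \<open>S\<close> are then irrelevant.\<close>

primrec Cn_on :: "nat \<Rightarrow> real set \<Rightarrow> (real \<Rightarrow> 'a::real_normed_vector) \<Rightarrow> bool" where
  "Cn_on 0 S f \<longleftrightarrow> continuous_on S f"
| "Cn_on (Suc n) S f \<longleftrightarrow>
     (\<exists>f'. (\<forall>x\<in>S. (f has_vector_derivative f' x) (at x)) \<and> Cn_on n S f')"

definition smooth :: "(real \<Rightarrow> 'a::real_normed_vector) \<Rightarrow> bool" where
  "smooth f \<longleftrightarrow> (\<forall>n. Cn_on n UNIV f)"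

text \<open>The oscillatory integral on the plane with radial cutoff \<open>a (\<delta>|\<xi>|)\<close>. All cutoffs used are
  bounded and supported in a compact subset of \<open>\<real> - {0}\<close>, so for \<open>g\<close> continuous on the positive
  half-line the integrand is integrable for every real \<open>s\<close>; the values of \<open>g\<close> and of \<open>powr\<close> at \<open>0\<close>
  play no role.\<close>

definition osc_integral ::
  "(real \<Rightarrow> complex) \<Rightarrow> (real \<Rightarrow> real) \<Rightarrow> real \<Rightarrow> real \<Rightarrow> real \<Rightarrow> real^2 \<Rightarrow> complex" where
  "osc_integral a g s \<delta> t x =
     (LINT \<xi>|lborel. exp (\<i> * complex_of_real (x \<bullet> \<xi>))
        * exp (\<i> * complex_of_real (t / \<delta> * g (\<delta> * norm \<xi>)))
        * a (\<delta> * norm \<xi>) * complex_of_real (norm \<xi> powr s))"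

definition I_block ::
  "(real \<Rightarrow> complex) \<Rightarrow> (real \<Rightarrow> real) \<Rightarrow> real \<Rightarrow> real \<Rightarrow> real \<Rightarrow> real^2 \<Rightarrow> int \<Rightarrow> complex" where
  "I_block P g s \<delta> t x k = osc_integral (\<lambda>y. P (y / 2 powi k)) g s \<delta> t x"

definition block_cutoff :: "(real \<Rightarrow> complex) \<Rightarrow> bool" where
  "block_cutoff P \<longleftrightarrow> smooth P \<and> (\<forall>y. P (- y) = P y)
     \<and> closure {y. P y \<noteq> 0} \<subseteq> {-2..-1/2} \<union> {1/2..2}"

definition LP_cutoff :: "(real \<Rightarrow> real) \<Rightarrow> bool" where
  "LP_cutoff \<phi> \<longleftrightarrow> smooth \<phi> \<and> (\<forall>y. 0 \<le> \<phi> y) \<and> (\<forall>y. \<phi> (- y) = \<phi> y)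
     \<and> closure {y. \<phi> y \<noteq> 0} \<subseteq> {-4/5..4/5}
     \<and> (\<forall>y\<in>{-3/5..3/5}. \<phi> y = 1) \<and> antimono_on {0..} \<phi>"

definition LP_Q :: "(real \<Rightarrow> real) \<Rightarrow> int \<Rightarrow> real \<Rightarrow> real" where
  "LP_Q \<phi> j y = \<phi> (2 powi (- j - 1) * y) - \<phi> (2 powi (- j) * y)"

end

theory Submission
  imports Defs
begin

text \<open>After rescaling to \<open>\<delta> = 1\<close> the integral has phase \<open>X \<bullet> \<xi> + T g(|\<xi>|)\<close> with
  \<open>X = x / \<delta>\<close> and \<open>T = t / \<delta>\<close>. If \<open>|X|\<close> is at least a small multiple of \<open>|T|\<close>, the
  integral over the circles, a Bessel function, decays like \<open>|X| powr (-1/2)\<close>, whatever \<open>g\<close> is.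
  Otherwise the linear term is a small perturbation of the radial phase \<open>T g(r)\<close>, and the lemma of
  van der Corput applies along the rays: in (2) with the derivative of order \<open>p \<le> l\<close> that is
  bounded below near the given point, in (1) with the first derivative. Polar coordinates are
  avoided by averaging the planar integral over rotations, respectively over dilations by
  \<open>\<rho> \<in> [1, 2]\<close>. Part (1) is uniform in \<open>k\<close> because, for \<open>r\<close> of size 1, the phase
  \<open>T g(2^k r)\<close> has derivative at least \<open>2^k |T| lam\<close> and boundedly many inflection points.\<close>

section \<open>Van der Corput estimates\<close>

text \<open>Averaging over dilations leaves a phase \<open>\<mu> r + T g(r)\<close> on each ray,
  with \<open>\<bar>\<mu>\<bar> \<le> \<bar>X\<bar>\<close>, so all one-dimensional estimates have
  to be uniform in \<open>\<mu>\<close>. The exponent -1/2 of the circle integral is good enough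
  because \<open>l \<ge> 2\<close>, and for phases of size below 1 the trivial bound suffices. The
  obstacle in (1) is that \<open>g''\<close> may blow up at the origin: the integral of
  \<open>\<bar>f''\<bar> / f'^2\<close> left by an integration by parts cannot be bounded through a
  supremum uniformly in \<open>k\<close>. Between consecutive zeros of \<open>g''\<close> it
  telescopes instead, and the number of zeros does not grow under dilation. In (2) the interval is
  compact, but the order of the derivative that is bounded below changes from point to point; local
  estimates are glued by bisection. The power of \<open>2^k\<close> in (1) arises because the
  dilation divides both \<open>t\<close> and \<open>\<delta>\<close> by \<open>2^k\<close>:
  \<open>t / \<delta>\<close> stays the same, while the prefactor and the size of the phase
  change.\<close>

lemma has_vector_derivative_cis:
  assumes "(f has_real_derivative d) (at x within S)"
  shows "((\<lambda>x. cis (f x)) has_vector_derivative (\<i> * of_real d * cis (f x))) (at x within S)"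
proof -
  have "((\<lambda>x. cis (f x)) has_derivative (\<lambda>t. (t * d) *\<^sub>R (\<i> * cis (f x)))) (at x within S)"
    using assms by (intro has_derivative_cis) (simp add: has_field_derivative_def mult.commute[of _ d])
  then show ?thesis
    by (simp add: has_vector_derivative_def scaleR_conv_of_real mult_ac)
qed

lemma norm_integral_cis_le:
  assumes "a \<le> b" "continuous_on {a..b} f"
  shows "norm (integral {a..b} (\<lambda>x. cis (f x))) \<le> b - a"
  using integral_bound[of a b "\<lambda>x. cis (f x)" 1] assms by (auto intro!: continuous_intros)

text \<open>Integration by parts: \<open>cis f\<close> is the derivative of
  \<open>cis f / (\<i> f')\<close> up to a term of modulus \<open>\<bar>f''\<bar> / f'^2\<close>.
  This error is kept as an integral, so that either a supremum of \<open>f''\<close> or the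
  constancy of its sign can be used on it.\<close>

lemma van_der_corput_first:
  fixes f f' f'' :: "real \<Rightarrow> real"
  assumes ab: "a \<le> b"
    and f': "\<And>x. x \<in> {a..b} \<Longrightarrow> (f has_real_derivative f' x) (at x within {a..b})"
    and f'': "\<And>x. x \<in> {a..b} \<Longrightarrow> (f' has_real_derivative f'' x) (at x within {a..b})"
    and cont: "continuous_on {a..b} f''"
    and m: "m > 0" "\<And>x. x \<in> {a..b} \<Longrightarrow> m \<le> \<bar>f' x\<bar>"
  shows "norm (integral {a..b} (\<lambda>x. cis (f x))) \<le> 2 / m + integral {a..b} (\<lambda>x. \<bar>f'' x\<bar> / (f' x)\<^sup>2)"
proof -
  have nz: "f' x \<noteq> 0" if "x \<in> {a..b}" for x using m that by force
  have cf: "continuous_on {a..b} f"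
    using f' DERIV_continuous_on by blast
  have cf': "continuous_on {a..b} f'"
    using f'' DERIV_continuous_on by blast
  define F where "F x = - \<i> * of_real (1 / f' x) * cis (f x)" for x
  define G where "G x = - \<i> * of_real (f'' x / (f' x)\<^sup>2) * cis (f x)" for x
  have dF: "(F has_vector_derivative (cis (f x) - G x)) (at x within {a..b})" if "x \<in> {a..b}" for x
  proof -
    have 1: "((\<lambda>x. 1 / f' x) has_real_derivative (- f'' x / (f' x)\<^sup>2)) (at x within {a..b})"
      using nz[OF that] f''[OF that] by (auto intro!: derivative_eq_intros simp: power2_eq_square)
    have "((\<lambda>x. complex_of_real (1 / f' x)) has_vector_derivative of_real (- f'' x / (f' x)\<^sup>2)) (at x within {a..b})"
      using has_vector_derivative_of_real[OF 1] .
    from has_vector_derivative_mult[OF has_vector_derivative_mult_right[OF this, of "-\<i>"] has_vector_derivative_cis[OF f'[OF that]]]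
    have "(F has_vector_derivative (- \<i> * of_real (1 / f' x)) * (\<i> * of_real (f' x) * cis (f x))
       + (- \<i> * of_real (- f'' x / (f' x)\<^sup>2)) * cis (f x)) (at x within {a..b})"
      unfolding F_def by simp
    moreover have "(- \<i> * of_real (1 / f' x)) * (\<i> * of_real (f' x) * cis (f x))
       + (- \<i> * of_real (- f'' x / (f' x)\<^sup>2)) * cis (f x) = cis (f x) - G x"
      using nz[OF that] by (simp add: G_def field_simps)
    ultimately show ?thesis by argo
  qed
  have ci: "continuous_on {a..b} (\<lambda>x. cis (f x))"
    by (intro continuous_intros cf)
  have cG: "continuous_on {a..b} G"
    unfolding G_def by (intro continuous_intros cf cf' cont) (use nz in auto)
  have "((\<lambda>x. cis (f x) - G x) has_integral (F b - F a)) {a..b}"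
    by (rule fundamental_theorem_of_calculus[OF ab dF])
  then have "integral {a..b} (\<lambda>x. cis (f x)) - integral {a..b} G = F b - F a"
    using ci cG by (metis integral_diff integral_unique integrable_continuous_real)
  then have eq: "integral {a..b} (\<lambda>x. cis (f x)) = F b - F a + integral {a..b} G"
    by (simp add: algebra_simps)
  have F: "norm (F x) \<le> 1 / m" if "x \<in> {a..b}" for x
    using m that nz by (simp add: F_def norm_mult norm_divide frac_le)
  have "norm (integral {a..b} G) \<le> integral {a..b} (\<lambda>x. \<bar>f'' x\<bar> / (f' x)\<^sup>2)"
  proof (rule integral_norm_bound_integral)
    show "G integrable_on {a..b}" using cG by (rule integrable_continuous_real)
    show "(\<lambda>x. \<bar>f'' x\<bar> / (f' x)\<^sup>2) integrable_on {a..b}"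
      by (rule integrable_continuous_real) (intro continuous_intros cf' cont, use nz in auto)
    show "norm (G x) \<le> \<bar>f'' x\<bar> / (f' x)\<^sup>2" for x
      by (simp add: G_def norm_mult norm_divide norm_power)
  qed
  then have "norm (F b - F a + integral {a..b} G) \<le> 1/m + 1/m + integral {a..b} (\<lambda>x. \<bar>f'' x\<bar> / (f' x)\<^sup>2)"
    using F[of a] F[of b] ab
    by (intro order_trans[OF norm_triangle_ineq] add_mono order_trans[OF norm_triangle_ineq4]) auto
  then show ?thesis unfolding eq by simp
qed

text \<open>Where \<open>f''\<close> keeps one sign, \<open>\<bar>f''\<bar> / f'^2\<close> is, up to
  that sign, the derivative of \<open>-1 / f'\<close>. Its integral telescopes to at most
  \<open>2 / m\<close>; neither the length of the interval nor the size of \<open>f''\<close>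
  enters.\<close>

lemma van_der_corput_first_convex:
  fixes f f' f'' :: "real \<Rightarrow> real"
  assumes ab: "a \<le> b"
    and f': "\<And>x. x \<in> {a..b} \<Longrightarrow> (f has_real_derivative f' x) (at x within {a..b})"
    and f'': "\<And>x. x \<in> {a..b} \<Longrightarrow> (f' has_real_derivative f'' x) (at x within {a..b})"
    and cont: "continuous_on {a..b} f''"
    and m: "m > 0" "\<And>x. x \<in> {a..b} \<Longrightarrow> m \<le> \<bar>f' x\<bar>"
    and sign: "\<And>x y. x \<in> {a<..<b} \<Longrightarrow> y \<in> {a<..<b} \<Longrightarrow> f'' x > 0 \<Longrightarrow> f'' y \<ge> 0"
  shows "norm (integral {a..b} (\<lambda>x. cis (f x))) \<le> 4 / m"
proof -
  have nz: "f' x \<noteq> 0" if "x \<in> {a..b}" for x using m that by force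
  \<comment> \<open>If \<open>f''\<close> has no positive value in the open interval, then
    \<open>f'' \<le> 0\<close> there and -1 is correct, also for vanishing
    \<open>f''\<close>.\<close>
  define \<sigma> :: real where "\<sigma> = (if \<exists>x\<in>{a<..<b}. f'' x > 0 then 1 else -1)"
  have s: "\<bar>f'' x\<bar> = \<sigma> * f'' x" if "x \<in> {a<..<b}" for x
    using sign that unfolding \<sigma>_def by (auto split: if_splits) (meson abs_of_nonpos greaterThanLessThan_iff linorder_not_less)
  have "((\<lambda>x. f'' x / (f' x)\<^sup>2) has_integral (- 1 / f' b - (- 1 / f' a))) {a..b}"
  proof (rule fundamental_theorem_of_calculus[OF ab])
    fix x assume x: "x \<in> {a..b}"
    have "((\<lambda>x. - 1 / f' x) has_real_derivative (f'' x / (f' x)\<^sup>2)) (at x within {a..b})"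
      using nz[OF x] f''[OF x] by (auto intro!: derivative_eq_intros simp: power2_eq_square)
    then show "((\<lambda>x. - 1 / f' x) has_vector_derivative (f'' x / (f' x)\<^sup>2)) (at x within {a..b})"
      by (simp add: has_real_derivative_iff_has_vector_derivative)
  qed
  then have "((\<lambda>x. \<sigma> * (f'' x / (f' x)\<^sup>2)) has_integral \<sigma> * (- 1 / f' b - (- 1 / f' a))) {a..b}"
    by (rule has_integral_mult_right)
  \<comment> \<open>The sign is known in the open interval only, hence the two endpoints are
    exempted.\<close>
  then have "((\<lambda>x. \<bar>f'' x\<bar> / (f' x)\<^sup>2) has_integral \<sigma> * (- 1 / f' b - (- 1 / f' a))) {a..b}"
    by (rule has_integral_spike_finite[of "{a,b}", rotated 2]) (use s in auto)
  then have "integral {a..b} (\<lambda>x. \<bar>f'' x\<bar> / (f' x)\<^sup>2) = \<sigma> * (- 1 / f' b - (- 1 / f' a))"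
    by (rule integral_unique)
  also have "\<dots> \<le> \<bar>1 / f' b\<bar> + \<bar>1 / f' a\<bar>"
  proof -
    have "\<sigma> * (- x - (- y)) \<le> \<bar>x\<bar> + \<bar>y\<bar>" for x y :: real
      unfolding \<sigma>_def by (auto simp: abs_if)
    from this[of "1 / f' b" "1 / f' a"] show ?thesis by simp
  qed
  also have "\<dots> \<le> 1 / m + 1 / m"
    using m ab by (simp only: abs_divide abs_one, intro add_mono frac_le) auto
  finally show ?thesis
    using van_der_corput_first[OF ab f' f'' cont m] by simp
qed

lemma continuous_nonzero_same_sign:
  fixes f :: "real \<Rightarrow> real"
  assumes "continuous_on {a..b} f" "\<And>x. x \<in> {a<..<b} \<Longrightarrow> f x \<noteq> 0"
    and "x \<in> {a<..<b}" "y \<in> {a<..<b}" "f x > 0"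
  shows "f y \<ge> 0"
proof (rule ccontr)
  assume "\<not> f y \<ge> 0"
  have "connected (f ` {a<..<b})"
    by (rule connected_continuous_image) (auto intro: continuous_on_subset[OF assms(1)])
  then have "0 \<in> f ` {a<..<b}"
    using connectedD_interval[of "f ` {a<..<b}" "f y" "f x" 0] assms \<open>\<not> f y \<ge> 0\<close> by auto
  with assms(2) show False by auto
qed

text \<open>Cutting at a point of \<open>Z\<close> at most doubles the bound, so only
  \<open>card Z\<close> matters and not where the points lie. \<open>Z\<close> has to contain the
  interior zeros but may be larger, which lets the hypothesis pass to subintervals.\<close>

lemma van_der_corput_first_finite:
  fixes f f' f'' :: "real \<Rightarrow> real"
  assumes "a \<le> b"
    and "\<And>x. x \<in> {a..b} \<Longrightarrow> (f has_real_derivative f' x) (at x within {a..b})"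
    and "\<And>x. x \<in> {a..b} \<Longrightarrow> (f' has_real_derivative f'' x) (at x within {a..b})"
    and "continuous_on {a..b} f''"
    and m: "m > 0" and "\<And>x. x \<in> {a..b} \<Longrightarrow> m \<le> \<bar>f' x\<bar>"
    and "finite Z" "\<And>x. x \<in> {a<..<b} \<Longrightarrow> f'' x = 0 \<Longrightarrow> x \<in> Z"
  shows "norm (integral {a..b} (\<lambda>x. cis (f x))) \<le> 4 * 2 ^ card Z / m"
  using assms(7) assms(1-4,6,8)
proof (induction Z arbitrary: a b rule: finite_induct)
  case empty
  have "norm (integral {a..b} (\<lambda>x. cis (f x))) \<le> 4 / m"
  proof (rule van_der_corput_first_convex[of a b f f' f''])
    show "0 \<le> f'' y" if "x \<in> {a<..<b}" "y \<in> {a<..<b}" "0 < f'' x" for x y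
      by (rule continuous_nonzero_same_sign[of a b f'' x y]) (use that empty in auto)
  qed (use empty m in blast)+
  then show ?case by simp
next
  case (insert c Z)
  show ?case
  proof (cases "c \<in> {a<..<b}")
    case False
    have "norm (integral {a..b} (\<lambda>x. cis (f x))) \<le> 4 * 2 ^ card Z / m"
      by (rule insert.IH) (use insert.prems False in auto)
    also have "\<dots> \<le> 4 * 2 ^ card (insert c Z) / m"
      using insert m by (simp add: divide_right_mono)
    finally show ?thesis .
  next
    case True
    have cf: "continuous_on {a..b} f"
      using insert.prems DERIV_continuous_on by blast
    \<comment> \<open>\<open>c\<close> becomes an endpoint of both pieces, and a zero at an endpoint
      is not asked to lie in \<open>Z\<close>.\<close>
    have L: "norm (integral {u..v} (\<lambda>x. cis (f x))) \<le> 4 * 2 ^ card Z / m"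
      if uv: "a \<le> u" "u \<le> v" "v \<le> b" "c \<notin> {u<..<v}" for u v
    proof (rule insert.IH)
      show "u \<le> v" by fact
      show "(f has_real_derivative f' x) (at x within {u..v})" if "x \<in> {u..v}" for x
        using insert.prems(2)[of x] that uv by (auto intro: DERIV_subset)
      show "(f' has_real_derivative f'' x) (at x within {u..v})" if "x \<in> {u..v}" for x
        using insert.prems(3)[of x] that uv by (auto intro: DERIV_subset)
      show "continuous_on {u..v} f''"
        using insert.prems(4) uv by (auto intro: continuous_on_subset)
      show "m \<le> \<bar>f' x\<bar>" if "x \<in> {u..v}" for x
        using insert.prems(5)[of x] that uv by auto
      show "x \<in> Z" if "x \<in> {u<..<v}" "f'' x = 0" for x
        using insert.prems(6)[of x] that uv by auto
    qed
    have "integral {a..b} (\<lambda>x. cis (f x)) = integral {a..c} (\<lambda>x. cis (f x)) + integral {c..b} (\<lambda>x. cis (f x))"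
      using True cf by (intro Henstock_Kurzweil_Integration.integral_combine[symmetric] integrable_continuous_real continuous_intros) auto
    also have "norm \<dots> \<le> 4 * 2 ^ card Z / m + 4 * 2 ^ card Z / m"
      using True by (intro order_trans[OF norm_triangle_ineq] add_mono L) auto
    also have "\<dots> = 4 * 2 ^ card (insert c Z) / m"
      using insert by (simp add: field_simps)
    finally show ?thesis .
  qed
qed

section \<open>Van der Corput estimates by derivatives of higher order\<close>

lemma mean_value_abs_lower:
  fixes f f' :: "real \<Rightarrow> real"
  assumes f': "\<And>x. x \<in> {a..b} \<Longrightarrow> (f has_real_derivative f' x) (at x within {a..b})"
    and lam: "\<And>x. x \<in> {a..b} \<Longrightarrow> lam \<le> \<bar>f' x\<bar>"
    and "x \<in> {a..b}" "y \<in> {a..b}"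
  shows "lam * \<bar>x - y\<bar> \<le> \<bar>f x - f y\<bar>"
  using assms(3,4)
proof (induction x y rule: linorder_wlog)
  case (le x y)
  show ?case
  proof (cases "x = y")
    case False
    with le have "x < y" by simp
    have d: "(f has_derivative (\<lambda>h. f' z * h)) (at z within {x..y})" if "x \<le> z" "z \<le> y" for z
      using f'[of z] that le unfolding has_field_derivative_def
      by (auto intro: has_derivative_subset)
    obtain z where "z \<in> {x<..<y}" "f y - f x = f' z * (y - x)"
      using mvt_simple[OF \<open>x < y\<close> d] by auto
    moreover from this le have "lam \<le> \<bar>f' z\<bar>" using lam[of z] by auto
    ultimately show ?thesis
      using \<open>x < y\<close> by (simp add: abs_minus_commute[of "f x"] abs_mult mult_right_mono)
  qed auto
next
  case (sym x y)
  then show ?case by (simp add: abs_minus_commute)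
qed

text \<open>Away from the point where \<open>\<bar>f\<bar>\<close> is minimal, \<open>\<bar>f\<bar>\<close> grows linearly; the neighbourhood that is
  cut out there has length \<open>lam powr (-1/(k+1))\<close>, which balances the two contributions.\<close>

lemma van_der_corput_step:
  fixes f f' :: "real \<Rightarrow> real" and \<psi> :: "real \<Rightarrow> real" and C k :: real
  assumes ab: "a \<le> b"
    and f': "\<And>x. x \<in> {a..b} \<Longrightarrow> (f has_real_derivative f' x) (at x within {a..b})"
    and lam: "lam > 0" "\<And>x. x \<in> {a..b} \<Longrightarrow> lam \<le> \<bar>f' x\<bar>"
    and cont: "continuous_on {a..b} \<psi>"
    and C: "C \<ge> 0" and k: "k \<ge> 1"
    and prev: "\<And>u v m. a \<le> u \<Longrightarrow> u \<le> v \<Longrightarrow> v \<le> b \<Longrightarrow> m > 0 \<Longrightarrow> (\<And>x. x \<in> {u..v} \<Longrightarrow> m \<le> \<bar>f x\<bar>) \<Longrightarrow>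
       norm (integral {u..v} (\<lambda>x. cis (\<psi> x))) \<le> C * m powr (- 1 / k)"
  shows "norm (integral {a..b} (\<lambda>x. cis (\<psi> x))) \<le> (2 + 4 * C) * lam powr (- 1 / (k + 1))"
proof -
  \<comment> \<open>\<open>f\<close> plays the role of the derivative of order \<open>k\<close> of
    the phase \<open>\<psi>\<close>; the two are linked only through \<open>prev\<close>.\<close>
  have cf: "continuous_on {a..b} f"
    using f' DERIV_continuous_on by blast
  obtain c where c: "c \<in> {a..b}" "\<And>x. x \<in> {a..b} \<Longrightarrow> \<bar>f c\<bar> \<le> \<bar>f x\<bar>"
    using continuous_attains_inf[of "{a..b}" "\<lambda>x. \<bar>f x\<bar>"] ab continuous_on_rabs[OF cf]
    by (metis atLeastatMost_empty_iff2 compact_Icc linorder_not_less)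
  \<comment> \<open>By minimality at \<open>c\<close>, the difference
    \<open>\<bar>f x - f c\<bar>\<close> is at most \<open>2 * \<bar>f x\<bar>\<close>, whence the
    factor 1/2. It never has to be decided whether \<open>f\<close> vanishes somewhere.\<close>
  have grow: "lam / 2 * \<bar>x - c\<bar> \<le> \<bar>f x\<bar>" if "x \<in> {a..b}" for x
    using mean_value_abs_lower[of a b f f' lam x c, OF f' lam(2) that c(1)] c(2)[OF that] by auto
  define e where "e = lam powr (- 1 / (k + 1))"
  have e: "e > 0" using lam by (simp add: e_def)
  \<comment> \<open>Lower bound of \<open>\<bar>f\<bar>\<close> at distance \<open>e\<close> or more
    from \<open>c\<close>. The choice of \<open>e\<close> makes
    \<open>(lam * e) powr (- 1 / k)\<close> equal to \<open>e\<close>, and halving costs a factor of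
    at most 2 as \<open>k \<ge> 1\<close>.\<close>
  define m where "m = lam * e / 2"
  have m: "m > 0" using e lam by (simp add: m_def)
  have "lam * e = lam powr (k / (k + 1))"
    unfolding e_def using lam k powr_mult_base[of lam "- 1 / (k+1)"] by (simp add: field_simps)
  then have "(lam * e) powr (- 1 / k) = e"
    using k by (simp add: powr_powr e_def)
  then have "m powr (- 1 / k) = e * (1/2) powr (-1/k)"
    using e lam powr_mult[of "lam * e" "1/2" "-1/k"] by (simp add: m_def)
  also have "(1/2::real) powr (-1/k) = 2 powr (1 / k)"
    by (simp add: powr_divide powr_minus_divide)
  also have "\<dots> \<le> 2 powr 1" using k by (intro powr_mono) auto
  finally have mk: "m powr (- 1 / k) \<le> e * 2" using e by simp
  have far: "norm (integral {u..v} (\<lambda>x. cis (\<psi> x))) \<le> C * (e * 2)"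
    if "a \<le> u" "u \<le> v" "v \<le> b" "\<And>x. x \<in> {u..v} \<Longrightarrow> e \<le> \<bar>x - c\<bar>" for u v
  proof -
    have "m \<le> \<bar>f x\<bar>" if x: "x \<in> {u..v}" for x
    proof -
      have "m = lam / 2 * e" by (simp add: m_def)
      also have "\<dots> \<le> lam / 2 * \<bar>x - c\<bar>" using that(1) lam \<open>\<And>x. x \<in> {u..v} \<Longrightarrow> e \<le> \<bar>x - c\<bar>\<close>[OF x]
        by (intro mult_left_mono) auto
      also have "\<dots> \<le> \<bar>f x\<bar>" using x \<open>a \<le> u\<close> \<open>v \<le> b\<close> by (intro grow) auto
      finally show ?thesis .
    qed
    from prev[OF that(1-3) m this] mk C show ?thesis
      by (meson mult_left_mono order_trans)
  qed
  \<comment> \<open>An outer piece may degenerate to a point closer than \<open>e\<close> to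
    \<open>c\<close>, where \<open>far\<close> does not apply; its integral is then zero.\<close>
  define p q where "p = max a (c - e)" and "q = min b (c + e)"
  have pq: "a \<le> p" "p \<le> q" "q \<le> b" "q - p \<le> 2 * e" using c e by (auto simp: p_def q_def)
  have left: "norm (integral {a..p} (\<lambda>x. cis (\<psi> x))) \<le> C * (e * 2)"
  proof (cases "p = a")
    case False
    then show ?thesis using pq e by (intro far) (auto simp: p_def)
  qed (use C e in simp)
  have right: "norm (integral {q..b} (\<lambda>x. cis (\<psi> x))) \<le> C * (e * 2)"
  proof (cases "q = b")
    case False
    then show ?thesis using pq e by (intro far) (auto simp: q_def)
  qed (use C e in simp)
  have mid: "norm (integral {p..q} (\<lambda>x. cis (\<psi> x))) \<le> 2 * e"
    using norm_integral_cis_le[of p q \<psi>] pq continuous_on_subset[OF cont] by force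
  have int: "(\<lambda>x. cis (\<psi> x)) integrable_on {u..v}" if "a \<le> u" "v \<le> b" for u v
    using continuous_on_subset[OF cont] that by (intro integrable_continuous_real continuous_intros) auto
  have "integral {a..b} (\<lambda>x. cis (\<psi> x)) = integral {a..p} (\<lambda>x. cis (\<psi> x)) +
      (integral {p..q} (\<lambda>x. cis (\<psi> x)) + integral {q..b} (\<lambda>x. cis (\<psi> x)))"
    using pq int by (simp add: Henstock_Kurzweil_Integration.integral_combine)
  also have "norm \<dots> \<le> C * (e * 2) + (2 * e + C * (e * 2))"
    by (intro order_trans[OF norm_triangle_ineq] add_mono left right mid)
  finally show ?thesis by (simp add: e_def algebra_simps)
qed

text \<open>Orders start at 2: a lower bound on the first derivative alone gives no decay, while a
  lower bound on the second also fixes its sign. The constant is quantified before the interval and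
  the phase, so it depends on \<open>k\<close> only. \<open>D\<close> lists the phase and its
  successive derivatives.\<close>

lemma van_der_corput:
  assumes "k \<ge> 2"
  shows "\<exists>C\<ge>0. \<forall>a b lam. \<forall>D :: nat \<Rightarrow> real \<Rightarrow> real. a \<le> b \<longrightarrow> lam > 0 \<longrightarrow>
     (\<forall>p<k. \<forall>x\<in>{a..b}. (D p has_real_derivative D (Suc p) x) (at x within {a..b})) \<longrightarrow>
     continuous_on {a..b} (D k) \<longrightarrow> (\<forall>x\<in>{a..b}. lam \<le> \<bar>D k x\<bar>) \<longrightarrow>
     norm (integral {a..b} (\<lambda>x. cis (D 0 x))) \<le> C * lam powr (- 1 / real k)"
  using assms
proof (induction k rule: dec_induct)
  case base
  \<comment> \<open>\<open>D 1\<close> takes the place of \<open>f\<close> with exponent 1. The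
    second 4 is the constant for a second derivative of one sign, available because
    \<open>D 2\<close> has no zero.\<close>
  have "norm (integral {a..b} (\<lambda>x. cis (D 0 x))) \<le> (2 + 4 * 4) * lam powr (- 1 / (1 + 1))"
    if ab: "a \<le> b" and lam: "lam > 0"
      and D: "\<forall>p<2. \<forall>x\<in>{a..b}. (D p has_real_derivative D (Suc p) x) (at x within {a..b})"
      and cont: "continuous_on {a..b} (D 2)" and low: "\<forall>x\<in>{a..b}. lam \<le> \<bar>D 2 x\<bar>"
    for a b lam and D :: "nat \<Rightarrow> real \<Rightarrow> real"
  proof (rule van_der_corput_step[OF ab])
    show "(D 1 has_real_derivative D 2 x) (at x within {a..b})" if "x \<in> {a..b}" for x
      using D[rule_format, of 1 x] that by (simp add: numeral_2_eq_2)
    have D0: "(D 0 has_real_derivative D 1 x) (at x within {a..b})" if "x \<in> {a..b}" for x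
      using D[rule_format, of 0 x] that by simp
    then show "continuous_on {a..b} (D 0)"
      using DERIV_continuous_on by blast
    show "lam \<le> \<bar>D 2 x\<bar>" if "x \<in> {a..b}" for x using low that by blast
    fix u v m :: real assume uv: "a \<le> u" "u \<le> v" "v \<le> b" and m: "m > 0" "\<And>x. x \<in> {u..v} \<Longrightarrow> m \<le> \<bar>D 1 x\<bar>"
    have "norm (integral {u..v} (\<lambda>x. cis (D 0 x))) \<le> 4 / m"
    proof (rule van_der_corput_first_convex[OF \<open>u \<le> v\<close> _ _ _ m])
      show "(D 0 has_real_derivative D 1 x) (at x within {u..v})" if "x \<in> {u..v}" for x
        using D0[of x] that uv by (auto intro: DERIV_subset)
      show "(D 1 has_real_derivative D 2 x) (at x within {u..v})" if "x \<in> {u..v}" for x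
        using D[rule_format, of 1 x] that uv by (auto simp: numeral_2_eq_2 intro: DERIV_subset)
      show c2: "continuous_on {u..v} (D 2)"
        using cont uv by (auto intro: continuous_on_subset)
      show "0 \<le> D 2 y" if "x \<in> {u<..<v}" "y \<in> {u<..<v}" "0 < D 2 x" for x y
      proof (rule continuous_nonzero_same_sign[OF c2 _ that])
        show "D 2 z \<noteq> 0" if "z \<in> {u<..<v}" for z
          using low[rule_format, of z] that uv lam by auto
      qed
    qed
    then show "norm (integral {u..v} (\<lambda>x. cis (D 0 x))) \<le> 4 * m powr (- 1 / 1)"
      using m by (simp add: powr_minus_divide)
  qed (use lam in auto)
  then show ?case by (intro exI[of _ "18"]) auto
next
  case (step k)
  then obtain C where C: "C \<ge> 0" and IH: "\<And>a b lam. \<And>D :: nat \<Rightarrow> real \<Rightarrow> real. a \<le> b \<Longrightarrow> lam > 0 \<Longrightarrow>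
     (\<forall>p<k. \<forall>x\<in>{a..b}. (D p has_real_derivative D (Suc p) x) (at x within {a..b})) \<Longrightarrow>
     continuous_on {a..b} (D k) \<Longrightarrow> (\<forall>x\<in>{a..b}. lam \<le> \<bar>D k x\<bar>) \<Longrightarrow>
     norm (integral {a..b} (\<lambda>x. cis (D 0 x))) \<le> C * lam powr (- 1 / real k)"
    by blast
  have "norm (integral {a..b} (\<lambda>x. cis (D 0 x))) \<le> (2 + 4 * C) * lam powr (- 1 / (real k + 1))"
    if ab: "a \<le> b" and lam: "lam > 0"
      and D: "\<forall>p<Suc k. \<forall>x\<in>{a..b}. (D p has_real_derivative D (Suc p) x) (at x within {a..b})"
      and cont: "continuous_on {a..b} (D (Suc k))" and low: "\<forall>x\<in>{a..b}. lam \<le> \<bar>D (Suc k) x\<bar>"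
    for a b lam and D :: "nat \<Rightarrow> real \<Rightarrow> real"
  proof (rule van_der_corput_step[OF ab _ lam _ _ C])
    show Dk: "(D k has_real_derivative D (Suc k) x) (at x within {a..b})" if "x \<in> {a..b}" for x
      using D that by blast
    have D0: "(D 0 has_real_derivative D 1 x) (at x within {a..b})" if "x \<in> {a..b}" for x
      using D[rule_format, of 0 x] that by simp
    then show "continuous_on {a..b} (D 0)"
      using DERIV_continuous_on by blast
    have ck: "continuous_on {a..b} (D k)"
      using Dk DERIV_continuous_on by blast
    show "lam \<le> \<bar>D (Suc k) x\<bar>" if "x \<in> {a..b}" for x using low that by blast
    show "real k \<ge> 1" using step by simp
    fix u v m :: real assume uv: "a \<le> u" "u \<le> v" "v \<le> b" and m: "m > 0" "\<And>x. x \<in> {u..v} \<Longrightarrow> m \<le> \<bar>D k x\<bar>"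
    show "norm (integral {u..v} (\<lambda>x. cis (D 0 x))) \<le> C * m powr (- 1 / real k)"
    proof (rule IH[OF \<open>u \<le> v\<close> \<open>m > 0\<close>])
      show "\<forall>p<k. \<forall>x\<in>{u..v}. (D p has_real_derivative D (Suc p) x) (at x within {u..v})"
      proof (intro allI impI ballI)
        fix p x assume "p < k" "x \<in> {u..v}"
        then show "(D p has_real_derivative D (Suc p) x) (at x within {u..v})"
          using D[rule_format, of p x] uv by (auto intro: DERIV_subset)
      qed
      show "continuous_on {u..v} (D k)"
        using ck uv by (auto intro: continuous_on_subset)
    qed (use m in blast)
  qed
  then show ?case using C by (intro exI[of _ "2 + 4 * C"]) (auto simp: add.commute)
qed

text \<open>The oscillating factor is replaced by its primitive from \<open>u\<close>, and the
  derivative falls on the amplitude. This is why \<open>K\<close> has to bound the integrals over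
  all initial segments and not just the one over the whole interval.\<close>

lemma oscillatory_amplitude:
  fixes \<alpha> \<alpha>' :: "real \<Rightarrow> complex"
  assumes K: "\<And>r. r \<in> {u..v} \<Longrightarrow> norm (integral {u..r} (\<lambda>x. cis (\<psi> x))) \<le> K"
    and c\<psi>: "continuous_on {u..v} \<psi>"
    and d: "\<And>r. r \<in> {u..v} \<Longrightarrow> (\<alpha> has_vector_derivative \<alpha>' r) (at r within {u..v})"
    and c\<alpha>': "continuous_on {u..v} \<alpha>'"
    and M: "\<And>r. r \<in> {u..v} \<Longrightarrow> norm (\<alpha> r) \<le> M" "\<And>r. r \<in> {u..v} \<Longrightarrow> norm (\<alpha>' r) \<le> M'"
    and uv: "u \<le> v"
  shows "norm (integral {u..v} (\<lambda>x. cis (\<psi> x) * \<alpha> x)) \<le> K * (M + (v - u) * M')"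
proof -
  define E where "E r = integral {u..r} (\<lambda>x. cis (\<psi> x))" for r
  have cc: "continuous_on {u..v} (\<lambda>x. cis (\<psi> x))"
    by (intro continuous_intros c\<psi>)
  have dE: "(E has_vector_derivative cis (\<psi> r)) (at r within {u..v})" if "r \<in> {u..v}" for r
    unfolding E_def by (rule integral_has_vector_derivative[OF cc that])
  have cE: "continuous_on {u..v} E"
    using has_vector_derivative_continuous[OF dE] by (simp add: continuous_on_eq_continuous_within)
  have c\<alpha>: "continuous_on {u..v} \<alpha>"
    using has_vector_derivative_continuous[OF d] by (simp add: continuous_on_eq_continuous_within)
  have K0: "K \<ge> 0" using K[of u] uv by force
  have M0: "M \<ge> 0" using M(1)[of u] uv norm_ge_zero order_trans by (metis atLeastAtMost_iff order_refl)
  have "((\<lambda>r. E r * \<alpha>' r + cis (\<psi> r) * \<alpha> r) has_integral (E v * \<alpha> v - E u * \<alpha> u)) {u..v}"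
    by (rule fundamental_theorem_of_calculus[OF uv has_vector_derivative_mult[OF dE d]])
  moreover have "E u = 0" by (simp add: E_def)
  ultimately have "integral {u..v} (\<lambda>r. E r * \<alpha>' r + cis (\<psi> r) * \<alpha> r) = E v * \<alpha> v"
    by (simp add: integral_unique)
  moreover have "integral {u..v} (\<lambda>r. E r * \<alpha>' r + cis (\<psi> r) * \<alpha> r)
      = integral {u..v} (\<lambda>r. E r * \<alpha>' r) + integral {u..v} (\<lambda>r. cis (\<psi> r) * \<alpha> r)"
    by (intro integral_add integrable_continuous_real continuous_intros cE c\<alpha>' c\<alpha> c\<psi>)
  ultimately have eq: "integral {u..v} (\<lambda>r. cis (\<psi> r) * \<alpha> r) = E v * \<alpha> v - integral {u..v} (\<lambda>r. E r * \<alpha>' r)"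
    by (simp add: algebra_simps)
  have "norm (integral {u..v} (\<lambda>r. E r * \<alpha>' r)) \<le> K * M' * (v - u)"
  proof (rule integral_bound[OF uv])
    show "continuous_on {u..v} (\<lambda>r. E r * \<alpha>' r)"
      by (intro continuous_intros cE c\<alpha>')
    show "norm (E r * \<alpha>' r) \<le> K * M'" if "r \<in> {u..v}" for r
      unfolding norm_mult using K[OF that] M(2)[OF that] K0 by (intro mult_mono) (auto simp: E_def)
  qed
  moreover have "norm (E v * \<alpha> v) \<le> K * M"
    unfolding norm_mult using K[of v] M(1)[of v] uv K0 by (intro mult_mono) (auto simp: E_def)
  ultimately have "norm (E v * \<alpha> v - integral {u..v} (\<lambda>r. E r * \<alpha>' r)) \<le> K * M + K * M' * (v - u)"
    by (intro order_trans[OF norm_triangle_ineq4] add_mono)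
  then show ?thesis unfolding eq by (simp add: algebra_simps)
qed

section \<open>Phases of finite type and their linear perturbations\<close>

lemma sum_ge_imp_term_ge:
  fixes f :: "nat \<Rightarrow> real"
  assumes "(\<Sum>p=1..l. f p) \<ge> lam" "l \<ge> 1"
  shows "\<exists>p\<in>{1..l}. f p \<ge> lam / l"
proof (rule ccontr)
  assume "\<not> ?thesis"
  then have "(\<Sum>p=1..l. f p) < (\<Sum>p=1..l. lam / l)"
    using assms by (intro sum_strict_mono) (auto simp: not_le)
  then show False using assms by simp
qed

text \<open>A linear term \<open>\<mu> x\<close> only changes the first derivative of the phase, which is why a
  bound \<open>\<bar>\<mu>\<bar> \<le> c \<bar>T\<bar>\<close> on it is harmless.\<close>

lemma van_der_corput_finite_type:
  fixes D :: "nat \<Rightarrow> real \<Rightarrow> real"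
  assumes ab: "a \<le> b" and l: "l \<ge> 2" and lam: "lam > 0"
    and D: "\<And>p x. p < l \<Longrightarrow> x \<in> {a..b} \<Longrightarrow> (D p has_real_derivative D (Suc p) x) (at x within {a..b})"
    and cont: "continuous_on {a..b} (D l)"
    and low: "\<And>x. x \<in> {a..b} \<Longrightarrow> (\<Sum>p=1..l. \<bar>D p x\<bar>) \<ge> lam"
  shows "\<exists>c>0. \<exists>C\<ge>0. \<forall>T \<mu> u v. 1 \<le> \<bar>T\<bar> \<longrightarrow> \<bar>\<mu>\<bar> \<le> c * \<bar>T\<bar> \<longrightarrow> a \<le> u \<longrightarrow> u \<le> v \<longrightarrow> v \<le> b \<longrightarrow>
    norm (integral {u..v} (\<lambda>x. cis (\<mu> * x + T * D 0 x))) \<le> C * \<bar>T\<bar> powr (- 1 / real l)"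
proof -
  have cD: "continuous_on {a..b} (D p)" if "p \<le> l" for p
  proof (cases "p = l")
    case False
    with that have "p < l" by simp
    then show ?thesis using D[of p] DERIV_continuous_on by blast
  qed (use cont in simp)
  \<comment> \<open>Compactness is exploited by bisection, with constants that may depend on
    \<open>p\<close> and \<open>q\<close>. The guards \<open>a \<le> p\<close> and
    \<open>q \<le> b\<close> are there because \<open>Bolzano\<close> asks for \<open>P\<close> also
    on small intervals that stick out of \<open>{a..b}\<close>.\<close>
  define P where "P p q \<longleftrightarrow> (a \<le> p \<longrightarrow> q \<le> b \<longrightarrow> (\<exists>c>0. \<exists>C\<ge>0. \<forall>T \<mu> u v. 1 \<le> \<bar>T\<bar> \<longrightarrow> \<bar>\<mu>\<bar> \<le> c * \<bar>T\<bar> \<longrightarrow> p \<le> u \<longrightarrow> u \<le> v \<longrightarrow> v \<le> q \<longrightarrow>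
    norm (integral {u..v} (\<lambda>x. cis (\<mu> * x + T * D 0 x))) \<le> C * \<bar>T\<bar> powr (- 1 / real l)))" for p q
  have "P a b"
  proof (rule Bolzano[OF ab])
    fix p q r assume "P p q" "P q r" "p \<le> q" "q \<le> r"
    show "P p r"
      unfolding P_def
    proof (intro impI)
      assume "a \<le> p" "r \<le> b"
      obtain c1 C1 where 1: "c1 > 0" "C1 \<ge> 0"
        "\<And>T \<mu> u v. 1 \<le> \<bar>T\<bar> \<Longrightarrow> \<bar>\<mu>\<bar> \<le> c1 * \<bar>T\<bar> \<Longrightarrow> p \<le> u \<Longrightarrow> u \<le> v \<Longrightarrow> v \<le> q \<Longrightarrow>
          norm (integral {u..v} (\<lambda>x. cis (\<mu> * x + T * D 0 x))) \<le> C1 * \<bar>T\<bar> powr (- 1 / real l)"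
        using \<open>P p q\<close> \<open>a \<le> p\<close> \<open>r \<le> b\<close> \<open>q \<le> r\<close> unfolding P_def by (meson order_trans)
      obtain c2 C2 where 2: "c2 > 0" "C2 \<ge> 0"
        "\<And>T \<mu> u v. 1 \<le> \<bar>T\<bar> \<Longrightarrow> \<bar>\<mu>\<bar> \<le> c2 * \<bar>T\<bar> \<Longrightarrow> q \<le> u \<Longrightarrow> u \<le> v \<Longrightarrow> v \<le> r \<Longrightarrow>
          norm (integral {u..v} (\<lambda>x. cis (\<mu> * x + T * D 0 x))) \<le> C2 * \<bar>T\<bar> powr (- 1 / real l)"
        using \<open>P q r\<close> \<open>a \<le> p\<close> \<open>r \<le> b\<close> \<open>p \<le> q\<close> unfolding P_def by (meson order_trans)
      have "norm (integral {u..v} (\<lambda>x. cis (\<mu> * x + T * D 0 x))) \<le> (C1 + C2) * \<bar>T\<bar> powr (- 1 / real l)"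
        if T: "1 \<le> \<bar>T\<bar>" and \<mu>: "\<bar>\<mu>\<bar> \<le> min c1 c2 * \<bar>T\<bar>" and uv: "p \<le> u" "u \<le> v" "v \<le> r" for T \<mu> u v
      proof -
        have "min c1 c2 * \<bar>T\<bar> \<le> c1 * \<bar>T\<bar>" "min c1 c2 * \<bar>T\<bar> \<le> c2 * \<bar>T\<bar>"
          by (intro mult_right_mono; simp)+
        then have \<mu>': "\<bar>\<mu>\<bar> \<le> c1 * \<bar>T\<bar>" "\<bar>\<mu>\<bar> \<le> c2 * \<bar>T\<bar>"
          using \<mu> by auto
        have pos: "0 \<le> C1 * \<bar>T\<bar> powr (- 1 / real l)" "0 \<le> C2 * \<bar>T\<bar> powr (- 1 / real l)"
          using 1 2 by auto
        consider "v \<le> q" | "q \<le> u" | "u \<le> q" "q \<le> v" by linarith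
        then show ?thesis
        proof cases
          case L: 1
          show ?thesis using 1(3)[OF T \<mu>'(1) uv(1,2) L] pos by (simp add: distrib_right)
        next
          case R: 2
          show ?thesis using 2(3)[OF T \<mu>'(2) R uv(2,3)] pos by (simp add: distrib_right)
        next
          case 3
          have "continuous_on {u..v} (D 0)"
            using cD[of 0] uv \<open>a \<le> p\<close> \<open>r \<le> b\<close> by (auto intro: continuous_on_subset)
          then have "integral {u..v} (\<lambda>x. cis (\<mu> * x + T * D 0 x)) =
             integral {u..q} (\<lambda>x. cis (\<mu> * x + T * D 0 x)) + integral {q..v} (\<lambda>x. cis (\<mu> * x + T * D 0 x))"
            using 3 by (intro Henstock_Kurzweil_Integration.integral_combine[symmetric] integrable_continuous_real continuous_intros) auto
          also have "norm \<dots> \<le> C1 * \<bar>T\<bar> powr (- 1 / real l) + C2 * \<bar>T\<bar> powr (- 1 / real l)"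
            using 3 uv by (intro order_trans[OF norm_triangle_ineq] add_mono 1(3) 2(3) T \<mu>') auto
          finally show ?thesis by (simp add: distrib_right)
        qed
      qed
      then show "\<exists>c>0. \<exists>C\<ge>0. \<forall>T \<mu> u v. 1 \<le> \<bar>T\<bar> \<longrightarrow> \<bar>\<mu>\<bar> \<le> c * \<bar>T\<bar> \<longrightarrow> p \<le> u \<longrightarrow> u \<le> v \<longrightarrow> v \<le> r \<longrightarrow>
          norm (integral {u..v} (\<lambda>x. cis (\<mu> * x + T * D 0 x))) \<le> C * \<bar>T\<bar> powr (- 1 / real l)"
        using 1 2 by (intro exI[of _ "min c1 c2"] conjI exI[of _ "C1 + C2"]) auto
    qed
  next
    fix x assume x: "a \<le> x" "x \<le> b"
    obtain k where k: "k \<in> {1..l}" "\<bar>D k x\<bar> \<ge> lam / l"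
      using sum_ge_imp_term_ge[OF low[of x]] x l by auto
    \<comment> \<open>Some derivative has size at least \<open>4 * c\<close> at \<open>x\<close>.
      Continuity costs half of this, and for \<open>k = 1\<close> the linear term costs another
      \<open>c\<close>, so that \<open>c * \<bar>T\<bar>\<close> survives.\<close>
    define c where "c = lam / (4 * l)"
    have c: "c > 0" using lam l by (simp add: c_def)
    have "continuous_on {a..b} (D k)" using k by (intro cD) auto
    then obtain d where d: "d > 0" "\<And>y. y \<in> {a..b} \<Longrightarrow> dist y x < d \<Longrightarrow> dist (D k y) (D k x) < 2 * c"
      using x c unfolding continuous_on_iff by (metis atLeastAtMost_iff mult_pos_pos zero_less_numeral)
    have low': "2 * c \<le> \<bar>D k y\<bar>" if "y \<in> {a..b}" "\<bar>y - x\<bar> < d" for y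
    proof -
      have "lam / l = 4 * c" using l by (simp add: c_def)
      with d(2)[OF that(1)] that(2) k(2) show ?thesis by (auto simp: dist_real_def)
    qed
    have "P p q" if pq: "p \<le> x" "x \<le> q" "q - p < d" for p q
      unfolding P_def
    proof (intro impI)
      assume apq: "a \<le> p" "q \<le> b"
      \<comment> \<open>The order \<open>k\<close> varies with \<open>x\<close>; for
        \<open>\<bar>T\<bar> \<ge> 1\<close> the faster decay of a lower order is weakened to the
        common order \<open>l\<close>.\<close>
      have dec: "\<bar>T\<bar> powr (- 1 / real k) \<le> \<bar>T\<bar> powr (- 1 / real l)" if "1 \<le> \<bar>T\<bar>" for T :: real
        using that k by (intro powr_mono) (auto simp: field_simps)
      have "\<exists>C\<ge>0. \<forall>T \<mu> u v. 1 \<le> \<bar>T\<bar> \<longrightarrow> \<bar>\<mu>\<bar> \<le> c * \<bar>T\<bar> \<longrightarrow> p \<le> u \<longrightarrow> u \<le> v \<longrightarrow> v \<le> q \<longrightarrow>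
          norm (integral {u..v} (\<lambda>x. cis (\<mu> * x + T * D 0 x))) \<le> C * \<bar>T\<bar> powr (- 1 / real k)"
      proof (cases "k = 1")
        case True
        \<comment> \<open>\<open>D 1\<close> need not be monotone here. The supremum of
          \<open>D 2\<close> on the compact interval controls the error term, whose numerator is
          linear and whose denominator is quadratic in \<open>T\<close>.\<close>
        have "bounded (D 2 ` {a..b})"
          using l by (intro compact_imp_bounded compact_continuous_image cD) auto
        then obtain M where M: "M \<ge> 0" "\<And>y. y \<in> {a..b} \<Longrightarrow> \<bar>D 2 y\<bar> \<le> M"
          unfolding bounded_iff by (metis abs_ge_zero image_eqI order_trans real_norm_def empty_iff nle_le)
        have "norm (integral {u..v} (\<lambda>x. cis (\<mu> * x + T * D 0 x))) \<le> (2 / c + (b - a) * M / c\<^sup>2) * \<bar>T\<bar> powr (- 1 / real k)"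
          if T: "1 \<le> \<bar>T\<bar>" and \<mu>: "\<bar>\<mu>\<bar> \<le> c * \<bar>T\<bar>" and uv: "p \<le> u" "u \<le> v" "v \<le> q" for T \<mu> u v
        proof -
          have T0: "\<bar>T\<bar> > 0" using T by simp
          have sub: "{u..v} \<subseteq> {a..b}" using uv apq by auto
          have dn: "\<bar>y - x\<bar> < d" if "y \<in> {u..v}" for y using that uv pq by auto
          have low2: "c * \<bar>T\<bar> \<le> \<bar>\<mu> + T * D 1 y\<bar>" if "y \<in> {u..v}" for y
          proof -
            have "2 * c * \<bar>T\<bar> \<le> \<bar>T * D 1 y\<bar>"
              using low'[of y] dn[OF that] that sub True T0 by (auto simp: abs_mult mult.commute)
            then show ?thesis using \<mu> by linarith
          qed
          have "norm (integral {u..v} (\<lambda>x. cis (\<mu> * x + T * D 0 x)))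
             \<le> 2 / (c * \<bar>T\<bar>) + integral {u..v} (\<lambda>x. \<bar>T * D 2 x\<bar> / (\<mu> + T * D 1 x)\<^sup>2)"
          proof (rule van_der_corput_first[OF \<open>u \<le> v\<close>])
            fix y assume y: "y \<in> {u..v}"
            have 0: "(D 0 has_real_derivative D 1 y) (at y within {u..v})"
              using D[of 0 y] l y sub by (auto intro: DERIV_subset)
            show "((\<lambda>x. \<mu> * x + T * D 0 x) has_real_derivative \<mu> + T * D 1 y) (at y within {u..v})"
              by (auto intro!: derivative_eq_intros 0)
            have 1: "(D 1 has_real_derivative D 2 y) (at y within {u..v})"
              using DERIV_subset[OF D[of 1 y] sub] l subsetD[OF sub y] unfolding Suc_1 by simp
            show "((\<lambda>x. \<mu> + T * D 1 x) has_real_derivative T * D 2 y) (at y within {u..v})"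
              by (auto intro!: derivative_eq_intros 1 simp del: One_nat_def)
          next
            have "continuous_on {u..v} (D 2)" using continuous_on_subset[OF cD sub] l by auto
            then show "continuous_on {u..v} (\<lambda>a. T * D 2 a)" by (intro continuous_intros)
          qed (use c T low2 in auto)
          also have "integral {u..v} (\<lambda>x. \<bar>T * D 2 x\<bar> / (\<mu> + T * D 1 x)\<^sup>2) \<le> \<bar>T\<bar> * M / (c * \<bar>T\<bar>)\<^sup>2 * (v - u)"
          proof -
            have "norm (integral {u..v} (\<lambda>x. \<bar>T * D 2 x\<bar> / (\<mu> + T * D 1 x)\<^sup>2)) \<le> \<bar>T\<bar> * M / (c * \<bar>T\<bar>)\<^sup>2 * (v - u)"
            proof (rule integral_bound[OF \<open>u \<le> v\<close>])
              have nz: "\<mu> + T * D 1 y \<noteq> 0" if "y \<in> {u..v}" for y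
                using low2[OF that] mult_pos_pos[OF c T0] by auto
              have "continuous_on {u..v} (D 2)" "continuous_on {u..v} (D 1)"
                using continuous_on_subset[OF cD sub] l by auto
              then show "continuous_on {u..v} (\<lambda>x. \<bar>T * D 2 x\<bar> / (\<mu> + T * D 1 x)\<^sup>2)"
                using nz by (intro continuous_intros) auto
              fix y assume y: "y \<in> {u..v}"
              have "(c * \<bar>T\<bar>)\<^sup>2 \<le> \<bar>\<mu> + T * D 1 y\<bar>\<^sup>2"
                using low2[OF y] c by (intro power_mono) auto
              moreover have "\<bar>T * D 2 y\<bar> \<le> \<bar>T\<bar> * M"
                using M(2)[of y] y sub by (auto simp: abs_mult intro!: mult_left_mono)
              ultimately show "norm (\<bar>T * D 2 y\<bar> / (\<mu> + T * D 1 y)\<^sup>2) \<le> \<bar>T\<bar> * M / (c * \<bar>T\<bar>)\<^sup>2"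
                using c T0 by (auto intro!: frac_le simp: M(1))
            qed
            then show ?thesis by simp
          qed
          also have "\<bar>T\<bar> * M / (c * \<bar>T\<bar>)\<^sup>2 * (v - u) \<le> \<bar>T\<bar> * M / (c * \<bar>T\<bar>)\<^sup>2 * (b - a)"
            using uv apq M by (intro mult_left_mono) auto
          also have "2 / (c * \<bar>T\<bar>) + \<bar>T\<bar> * M / (c * \<bar>T\<bar>)\<^sup>2 * (b - a) = (2 / c + (b - a) * M / c\<^sup>2) * \<bar>T\<bar> powr (- 1 / real k)"
            using True T0 c by (simp add: powr_minus_divide field_simps power2_eq_square)
          finally show ?thesis by simp
        qed
        then show ?thesis using M c ab by (intro exI[of _ "2 / c + (b - a) * M / c\<^sup>2"]) auto
      next
        case False
        then have k2: "k \<ge> 2" "k \<le> l" using k by auto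
        obtain C where C: "C \<ge> 0" and vdc: "\<And>a b lam. \<And>D :: nat \<Rightarrow> real \<Rightarrow> real. a \<le> b \<Longrightarrow> lam > 0 \<Longrightarrow>
           (\<forall>p<k. \<forall>x\<in>{a..b}. (D p has_real_derivative D (Suc p) x) (at x within {a..b})) \<Longrightarrow>
           continuous_on {a..b} (D k) \<Longrightarrow> (\<forall>x\<in>{a..b}. lam \<le> \<bar>D k x\<bar>) \<Longrightarrow>
           norm (integral {a..b} (\<lambda>x. cis (D 0 x))) \<le> C * lam powr (- 1 / real k)"
          using van_der_corput[OF k2(1)] by blast
        have "norm (integral {u..v} (\<lambda>x. cis (\<mu> * x + T * D 0 x))) \<le> (C * (2 * c) powr (- 1 / real k)) * \<bar>T\<bar> powr (- 1 / real k)"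
          if T: "1 \<le> \<bar>T\<bar>" and \<mu>: "\<bar>\<mu>\<bar> \<le> c * \<bar>T\<bar>" and uv: "p \<le> u" "u \<le> v" "v \<le> q" for T \<mu> u v
        proof -
          have sub: "{u..v} \<subseteq> {a..b}" using uv apq by auto
          \<comment> \<open>The derivatives of the perturbed phase: \<open>\<mu>\<close> is visible
            in orders 0 and 1 only, and \<open>k \<ge> 2\<close>.\<close>
          define E where "E n y = (if n = 0 then \<mu> * y + T * D 0 y else if n = 1 then \<mu> + T * D 1 y else T * D n y)" for n :: nat and y
          have "norm (integral {u..v} (\<lambda>x. cis (E 0 x))) \<le> C * (2 * c * \<bar>T\<bar>) powr (- 1 / real k)"
          proof (rule vdc[OF \<open>u \<le> v\<close>])
            show "0 < 2 * c * \<bar>T\<bar>" using c T by auto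
            show "\<forall>n<k. \<forall>y\<in>{u..v}. (E n has_real_derivative E (Suc n) y) (at y within {u..v})"
            proof (intro allI impI ballI)
              fix n y assume n: "n < k" and y: "y \<in> {u..v}"
              have 0: "(D n has_real_derivative D (Suc n) y) (at y within {u..v})"
                using D[of n y] k2 n y sub by (auto intro: DERIV_subset)
              consider "n = 0" | "n = 1" | "n \<ge> 2" by linarith
              then show "(E n has_real_derivative E (Suc n) y) (at y within {u..v})"
              proof cases
                case 1
                have "((\<lambda>x. \<mu> * x + T * D 0 x) has_real_derivative \<mu> + T * D 1 y) (at y within {u..v})"
                  using 0 1 by (auto intro!: derivative_eq_intros)
                then show ?thesis using 1 by (simp add: E_def[abs_def])
              next
                case 2
                have "((\<lambda>x. \<mu> + T * D n x) has_real_derivative T * D (Suc n) y) (at y within {u..v})"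
                  using 0 by (auto intro!: derivative_eq_intros)
                then show ?thesis using 2 by (simp add: E_def[abs_def])
              next
                case 3
                have "((\<lambda>x. T * D n x) has_real_derivative T * D (Suc n) y) (at y within {u..v})"
                  using 0 by (auto intro!: derivative_eq_intros)
                then show ?thesis using 3 by (simp add: E_def[abs_def])
              qed
            qed
            have "continuous_on {u..v} (D k)"
              using continuous_on_subset[OF cD sub] k2 by auto
            then have "continuous_on {u..v} (\<lambda>y. T * D k y)" by (intro continuous_intros)
            moreover have "E k = (\<lambda>y. T * D k y)" using k2 by (auto simp: E_def)
            ultimately show "continuous_on {u..v} (E k)" by simp
            show "\<forall>y\<in>{u..v}. 2 * c * \<bar>T\<bar> \<le> \<bar>E k y\<bar>"
            proof
              fix y assume y: "y \<in> {u..v}"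
              have "2 * c \<le> \<bar>D k y\<bar>" using low'[of y] y sub uv pq by auto
              then show "2 * c * \<bar>T\<bar> \<le> \<bar>E k y\<bar>"
                using k2 by (auto simp: E_def abs_mult mult.commute intro!: mult_left_mono)
            qed
          qed
          moreover have "(2 * c * \<bar>T\<bar>) powr (- 1 / real k) = (2 * c) powr (- 1 / real k) * \<bar>T\<bar> powr (- 1 / real k)"
            by (rule powr_mult)
          ultimately show ?thesis by (simp add: E_def mult.assoc)
        qed
        then show ?thesis using C by (intro exI[of _ "C * (2 * c) powr (- 1 / real k)"]) auto
      qed
      then obtain C where C: "C \<ge> 0" "\<And>T \<mu> u v. 1 \<le> \<bar>T\<bar> \<Longrightarrow> \<bar>\<mu>\<bar> \<le> c * \<bar>T\<bar> \<Longrightarrow> p \<le> u \<Longrightarrow> u \<le> v \<Longrightarrow> v \<le> q \<Longrightarrow>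
          norm (integral {u..v} (\<lambda>x. cis (\<mu> * x + T * D 0 x))) \<le> C * \<bar>T\<bar> powr (- 1 / real k)"
        by blast
      have "norm (integral {u..v} (\<lambda>x. cis (\<mu> * x + T * D 0 x))) \<le> C * \<bar>T\<bar> powr (- 1 / real l)"
        if "1 \<le> \<bar>T\<bar>" "\<bar>\<mu>\<bar> \<le> c * \<bar>T\<bar>" "p \<le> u" "u \<le> v" "v \<le> q" for T \<mu> u v
        using C(2)[OF that] mult_left_mono[OF dec[OF that(1)] C(1)] by linarith
      then show "\<exists>c>0. \<exists>C\<ge>0. \<forall>T \<mu> u v. 1 \<le> \<bar>T\<bar> \<longrightarrow> \<bar>\<mu>\<bar> \<le> c * \<bar>T\<bar> \<longrightarrow> p \<le> u \<longrightarrow> u \<le> v \<longrightarrow> v \<le> q \<longrightarrow>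
          norm (integral {u..v} (\<lambda>x. cis (\<mu> * x + T * D 0 x))) \<le> C * \<bar>T\<bar> powr (- 1 / real l)"
        using c C(1) by blast
    qed
    then show "\<exists>d>0. \<forall>p q. p \<le> x \<and> x \<le> q \<and> q - p < d \<longrightarrow> P p q"
      using d(1) by blast
  qed
  then show ?thesis unfolding P_def by simp
qed

text \<open>Up to the factor \<open>2 * pi\<close> this is the Bessel function of order zero at
  \<open>sqrt (p^2 + q^2)\<close>. A shift of the angle turns the phase into
  \<open>R * cos x\<close>, and \<open>\<bar>sin x\<bar> + \<bar>cos x\<bar> \<ge> 1\<close> says
  that the cosine is of finite type with \<open>l = 2\<close>.\<close>

lemma circle_integral_decay:
  "\<exists>C\<ge>0. \<forall>p q. p\<^sup>2 + q\<^sup>2 > 0 \<longrightarrow>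
     norm (integral {0..2*pi} (\<lambda>\<theta>. cis (p * cos \<theta> + q * sin \<theta>))) \<le> C * sqrt (p\<^sup>2 + q\<^sup>2) powr (- 1 / 2)"
proof -
  define D where "D n x = cos (x + real n * pi / 2)" for n and x :: real
  \<comment> \<open>The interval is twice a period long because the shift by \<open>\<alpha>\<close>
    moves \<open>{0..2*pi}\<close> to \<open>{-\<alpha>..2*pi-\<alpha>}\<close>.\<close>
  have "\<exists>c>0. \<exists>C\<ge>0. \<forall>T \<mu> u v. 1 \<le> \<bar>T\<bar> \<longrightarrow> \<bar>\<mu>\<bar> \<le> c * \<bar>T\<bar> \<longrightarrow> -2*pi \<le> u \<longrightarrow> u \<le> v \<longrightarrow> v \<le> 2*pi \<longrightarrow>
    norm (integral {u..v} (\<lambda>x. cis (\<mu> * x + T * D 0 x))) \<le> C * \<bar>T\<bar> powr (- 1 / real 2)"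
  proof (rule van_der_corput_finite_type[where lam = 1])
    fix n x
    have "cos (x + pi / 2 + real n * pi / 2) = - sin (x + real n * pi / 2)"
      using minus_sin_cos_eq[of "x + real n * pi / 2"] by (simp add: algebra_simps)
    then show "(D n has_real_derivative D (Suc n) x) (at x within {-2*pi..2*pi})"
      unfolding D_def by (auto intro!: derivative_eq_intros simp: field_simps)
  next
    show "continuous_on {-2*pi..2*pi} (D 2)" unfolding D_def by (intro continuous_intros) auto
  next
    fix x :: real
    have "1 = (sin x)\<^sup>2 + (cos x)\<^sup>2" by (rule sin_cos_squared_add[symmetric])
    also have "\<dots> \<le> \<bar>sin x\<bar> + \<bar>cos x\<bar>"
      by (intro add_mono; metis abs_ge_zero abs_square_le_1 abs_cos_le_one abs_sin_le_one
          mult_left_le power2_abs power2_eq_square)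
    also have "\<dots> = (\<Sum>p=1..2. \<bar>D p x\<bar>)"
      by (simp add: D_def numeral_2_eq_2 cos_add)
    finally show "1 \<le> (\<Sum>p=1..2. \<bar>D p x\<bar>)" .
  qed auto
  then obtain c C where c: "c > 0" and C: "C \<ge> 0" and **: "\<And>T \<mu> u v. 1 \<le> \<bar>T\<bar> \<Longrightarrow> \<bar>\<mu>\<bar> \<le> c * \<bar>T\<bar> \<Longrightarrow>
    -2*pi \<le> u \<Longrightarrow> u \<le> v \<Longrightarrow> v \<le> 2*pi \<Longrightarrow>
    norm (integral {u..v} (\<lambda>x. cis (\<mu> * x + T * D 0 x))) \<le> C * \<bar>T\<bar> powr (- 1 / real 2)"
    by blast
  have *: "norm (integral {u..v} (\<lambda>x. cis (T * cos x))) \<le> C * T powr (- 1 / 2)"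
    if "1 \<le> T" "-2*pi \<le> u" "u \<le> v" "v \<le> 2*pi" for T u v
    using **[of T 0 u v] that c by (simp add: D_def)
  have "norm (integral {0..2*pi} (\<lambda>\<theta>. cis (p * cos \<theta> + q * sin \<theta>))) \<le> (C + 2 * pi) * sqrt (p\<^sup>2 + q\<^sup>2) powr (- 1 / 2)"
    if pq: "p\<^sup>2 + q\<^sup>2 > 0" for p q
  proof -
    define R where "R = sqrt (p\<^sup>2 + q\<^sup>2)"
    have R: "R > 0" using pq by (simp add: R_def)
    have "p\<^sup>2 + q\<^sup>2 = R\<^sup>2" by (simp add: R_def)
    then have "(p / R)\<^sup>2 + (q / R)\<^sup>2 = R\<^sup>2 / R\<^sup>2"
      by (simp only: power_divide add_divide_distrib[symmetric])
    then have "(p / R)\<^sup>2 + (q / R)\<^sup>2 = 1" using R by simp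
    then obtain \<alpha> where \<alpha>: "0 \<le> \<alpha>" "\<alpha> < 2 * pi" "p / R = cos \<alpha>" "q / R = sin \<alpha>"
      using sincos_total_2pi by metis
    show ?thesis
    proof (cases "R \<ge> 1")
      case True
      have "((\<lambda>x. cis (R * cos x)) has_integral integral {-\<alpha>..2*pi-\<alpha>} (\<lambda>x. cis (R * cos x))) (cbox (-\<alpha>) (2*pi-\<alpha>))"
        unfolding cbox_interval by (intro integrable_integral integrable_continuous_real continuous_intros)
      from has_integral_affinity[OF this, of 1 "-\<alpha>"]
      have "((\<lambda>x. cis (R * cos (x - \<alpha>))) has_integral integral {-\<alpha>..2*pi-\<alpha>} (\<lambda>x. cis (R * cos x))) {0..2*pi}"
        by (simp add: image_add_atLeastAtMost' algebra_simps)
      moreover have "R * cos (x - \<alpha>) = p * cos x + q * sin x" for x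
        using \<alpha>(3,4) R by (simp add: cos_diff field_simps)
      ultimately have "integral {0..2*pi} (\<lambda>\<theta>. cis (p * cos \<theta> + q * sin \<theta>)) = integral {-\<alpha>..2*pi-\<alpha>} (\<lambda>x. cis (R * cos x))"
        by (simp add: integral_unique)
      moreover have "norm (integral {-\<alpha>..2*pi-\<alpha>} (\<lambda>x. cis (R * cos x))) \<le> C * R powr (- 1 / 2)"
        using \<alpha> by (intro * True) auto
      ultimately show ?thesis by (simp add: R_def distrib_right add_increasing2)
    next
      case False
      \<comment> \<open>For \<open>R < 1\<close> the length of the circle is enough, since
        \<open>R powr (- 1 / 2)\<close> is at least 1.\<close>
      have "norm (integral {0..2*pi} (\<lambda>\<theta>. cis (p * cos \<theta> + q * sin \<theta>))) \<le> 2 * pi - 0"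
        by (intro norm_integral_cis_le continuous_intros) auto
      also have "\<dots> \<le> 2 * pi * R powr (- 1 / 2)"
      proof -
        have "R powr (1 / 2) \<le> 1" using False R by (intro powr_le1) auto
        then have "1 \<le> R powr (- 1 / 2)" using R by (simp add: powr_minus_divide)
        then show ?thesis by simp
      qed
      also have "\<dots> \<le> (C + 2 * pi) * R powr (- 1 / 2)"
        using C by (intro mult_right_mono) auto
      finally show ?thesis by (simp add: R_def)
    qed
  qed
  then show ?thesis using C by (intro exI[of _ "C + 2 * pi"]) auto
qed

section \<open>Averaging planar integrals\<close>

lemma lborel_integral_scaleR:
  fixes f :: "'a::euclidean_space \<Rightarrow> 'b::{banach, second_countable_topology}"
  assumes [measurable]: "f \<in> borel_measurable borel" and c: "c > 0"
  shows "(LINT x|lborel. f x) = c ^ DIM('a) *\<^sub>R (LINT x|lborel. f (c *\<^sub>R x))"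
proof -
  have "(LINT x|lborel. f x) = (LINT x|density (distr lborel borel (\<lambda>x. 0 + c *\<^sub>R x)) (\<lambda>_. \<bar>c\<bar>^DIM('a)). f x)"
    using lborel_affine[of c "0::'a"] c by simp
  also have "\<dots> = (LINT x|distr lborel borel (\<lambda>x. 0 + c *\<^sub>R x). c ^ DIM('a) *\<^sub>R f x)"
    using c by (subst integral_density) auto
  also have "\<dots> = (LINT x|lborel. c ^ DIM('a) *\<^sub>R f (c *\<^sub>R x))"
    by (subst integral_distr) auto
  finally show ?thesis by simp
qed

text \<open>\<open>lborel\<close> is determined by its values on boxes, and the preimage of a box is
  its image under the inverse of \<open>f\<close>, which is again orthogonal and so preserves
  Lebesgue measure.\<close>

lemma lborel_distr_orthogonal:
  fixes f :: "real^'n::{finite,wellorder} \<Rightarrow> real^'n::_"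
  assumes f: "orthogonal_transformation f"
  shows "distr lborel borel f = lborel"
proof (rule lborel_eqI[symmetric])
  have lin: "linear f" using f by (simp add: orthogonal_transformation_linear)
  have [measurable]: "f \<in> borel_measurable borel"
    using lin by (intro borel_measurable_continuous_onI linear_continuous_on linear_conv_bounded_linear[THEN iffD1])
  fix l u :: "real^'n::_" assume le: "\<And>b. b \<in> Basis \<Longrightarrow> l \<bullet> b \<le> u \<bullet> b"
  have inv: "orthogonal_transformation (inv f)" and bij: "bij f"
    using f by (simp_all add: orthogonal_transformation_inv orthogonal_transformation_bij)
  have im: "f -` box l u = inv f ` box l u"
    using bij by (simp add: bij_vimage_eq_inv_image)
  have bx: "box l u \<in> lmeasurable" by simp
  have meas: "f -` box l u \<in> sets borel"
    using measurable_sets[of f borel borel "box l u"] by simp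
  have "emeasure (distr lborel borel f) (box l u) = emeasure lborel (f -` box l u)"
    by (subst emeasure_distr) auto
  also have "\<dots> = emeasure lebesgue (f -` box l u)"
    using meas by simp
  also have "\<dots> = measure lebesgue (inv f ` box l u)"
    using measurable_orthogonal_image[OF inv bx] unfolding im by (simp add: emeasure_eq_measure2 fmeasurableD2)
  also have "\<dots> = measure lebesgue (box l u)"
    using measure_orthogonal_image[OF inv bx] by simp
  also have "\<dots> = emeasure lborel (box l u)"
    using bx by (simp add: emeasure_eq_measure2 fmeasurableD2)
  also have "\<dots> = (\<Prod>b\<in>Basis. (u - l) \<bullet> b)"
    using le by (simp add: emeasure_lborel_box_eq)
  finally show "emeasure (distr lborel borel f) (box l u) = (\<Prod>b\<in>Basis. (u - l) \<bullet> b)" .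
qed simp

text \<open>If all \<open>G \<theta>\<close> have the same integral, Fubini moves the average over
  \<open>\<theta>\<close> inside, and cancellation in \<open>\<theta>\<close> at each fixed point
  suffices. The problem becomes one-dimensional at the cost of the volume of a ball that carries the
  support.\<close>

lemma norm_integral_le_average:
  fixes G :: "real \<Rightarrow> 'a::euclidean_space \<Rightarrow> complex"
  assumes pq: "p < q"
    and meas: "(\<lambda>(\<theta>, \<xi>). G \<theta> \<xi>) \<in> borel_measurable borel"
    and inv: "\<And>\<theta>. \<theta> \<in> {p..q} \<Longrightarrow> (LINT \<xi>|lborel. G \<theta> \<xi>) = I"
    and bd: "\<And>\<theta> \<xi>. \<theta> \<in> {p..q} \<Longrightarrow> norm (G \<theta> \<xi>) \<le> M"
    and supp: "\<And>\<theta> \<xi>. \<theta> \<in> {p..q} \<Longrightarrow> norm \<xi> > R \<Longrightarrow> G \<theta> \<xi> = 0"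
    and inner: "\<And>\<xi>. norm (integral {p..q} (\<lambda>\<theta>. G \<theta> \<xi>)) \<le> K"
  shows "(q - p) * norm I \<le> K * measure lborel (cball (0::'a) R)"
proof -
  \<comment> \<open>The hypotheses on \<open>G\<close> hold for \<open>\<theta>\<close> in
    \<open>{p..q}\<close> only; after truncation \<open>H\<close> is bounded with bounded support on
    the whole product space, hence integrable.\<close>
  define H where "H \<theta> \<xi> = indicator {p..q} \<theta> *\<^sub>R G \<theta> \<xi>" for \<theta> \<xi>
  have mH: "case_prod H \<in> borel_measurable (lborel \<Otimes>\<^sub>M lborel)"
  proof -
    have [measurable]: "case_prod G \<in> borel_measurable (borel \<Otimes>\<^sub>M borel)"
      using meas by (simp add: borel_prod)
    have "(\<lambda>(\<theta>, \<xi>). H \<theta> \<xi>) \<in> borel_measurable (borel \<Otimes>\<^sub>M borel)"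
      unfolding H_def by measurable
    then show ?thesis by (simp add: lborel_prod borel_prod)
  qed
  have M: "M \<ge> 0" using bd[of p 0] pq norm_ge_zero order_trans by (metis atLeastAtMost_iff less_eq_real_def)
  have bH: "norm (H \<theta> \<xi>) \<le> M * indicator ({p..q} \<times> cball 0 R) (\<theta>, \<xi>)" for \<theta> \<xi>
    using bd[of \<theta> \<xi>] supp[of \<theta> \<xi>] by (auto simp: H_def indicator_def)
  have iH: "integrable (lborel \<Otimes>\<^sub>M lborel) (case_prod H)"
  proof (rule Bochner_Integration.integrable_bound[OF _ mH])
    show "integrable (lborel \<Otimes>\<^sub>M lborel) (\<lambda>x. M * indicator ({p..q} \<times> cball (0::'a) R) x :: real)"
      unfolding lborel_prod
      by (intro integrable_mult_right integrable_real_indicator emeasure_bounded_finite bounded_Times)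
        (auto intro!: borel_closed closed_Times)
    show "AE x in lborel \<Otimes>\<^sub>M lborel. norm (case_prod H x) \<le> norm (M * indicator ({p..q} \<times> cball (0::'a) R) x :: real)"
      using bH M by (auto intro!: always_eventually simp: abs_mult)
  qed
  have i1: "(LINT \<theta>|lborel. H \<theta> \<xi>) = integral {p..q} (\<lambda>\<theta>. G \<theta> \<xi>)" for \<xi>
  proof -
    have "integrable lborel (\<lambda>\<theta>. H \<theta> \<xi>)"
    proof (rule Bochner_Integration.integrable_bound[of _ "\<lambda>\<theta>. M * indicator {p..q} \<theta> :: real"])
      have "(\<lambda>\<theta>. case_prod H (\<theta>, \<xi>)) \<in> borel_measurable lborel"
        by (rule measurable_compose[OF _ mH]) simp
      then show "(\<lambda>\<theta>. H \<theta> \<xi>) \<in> borel_measurable lborel" by simp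
      show "integrable lborel (\<lambda>\<theta>. M * indicator {p..q} \<theta> :: real)"
        by (intro integrable_mult_right integrable_real_indicator emeasure_bounded_finite) auto
      show "AE \<theta> in lborel. norm (H \<theta> \<xi>) \<le> norm (M * indicator {p..q} \<theta> :: real)"
        using bd M by (auto intro!: always_eventually simp: H_def abs_mult indicator_def)
    qed
    then have "set_integrable lborel {p..q} (\<lambda>\<theta>. G \<theta> \<xi>)"
      by (simp add: set_integrable_def H_def)
    from set_borel_integral_eq_integral(2)[OF this] show ?thesis
      by (simp add: set_lebesgue_integral_def H_def)
  qed
  have "(LINT \<theta>|lborel. (LINT \<xi>|lborel. H \<theta> \<xi>)) = (LINT \<theta>|lborel. indicator {p..q} \<theta> *\<^sub>R I)"
    by (intro Bochner_Integration.integral_cong) (auto simp: H_def inv indicator_def)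
  also have "\<dots> = (q - p) *\<^sub>R I" using pq by simp
  finally have "(q - p) *\<^sub>R I = (LINT \<xi>|lborel. (LINT \<theta>|lborel. H \<theta> \<xi>))"
    using lborel_pair.Fubini_integral[OF iH] by simp
  then have "(q - p) * norm I = norm (LINT \<xi>|lborel. (LINT \<theta>|lborel. H \<theta> \<xi>))"
    using pq by (metis norm_scaleR abs_of_pos diff_gt_0_iff_gt)
  also have "\<dots> \<le> (LINT \<xi>|lborel. K * indicator (cball (0::'a) R) \<xi>)"
  proof (rule Bochner_Integration.integral_norm_bound_integral)
    show "integrable lborel (\<lambda>\<xi>. LINT \<theta>|lborel. H \<theta> \<xi>)"
      by (rule lborel_pair.integrable_snd[OF iH])
    show "integrable lborel (\<lambda>\<xi>. K * indicator (cball (0::'a) R) \<xi> :: real)"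
      by (intro integrable_mult_right integrable_real_indicator emeasure_bounded_finite) auto
    show "norm (LINT \<theta>|lborel. H \<theta> \<xi>) \<le> K * indicator (cball 0 R) \<xi>" for \<xi>
    proof (cases "norm \<xi> \<le> R")
      case True
      then show ?thesis using inner[of \<xi>] by (simp add: i1)
    next
      case False
      then have "H \<theta> \<xi> = 0" for \<theta> using supp[of \<theta> \<xi>] by (simp add: H_def indicator_def)
      then show ?thesis using False by simp
    qed
  qed
  also have "\<dots> = K * measure lborel (cball (0::'a) R)" by simp
  finally show ?thesis .
qed

section \<open>Rotations of the plane\<close>

definition rot2 :: "real \<Rightarrow> real^2 \<Rightarrow> real^2" where
  "rot2 \<theta> \<xi> = vector [cos \<theta> * \<xi>$1 - sin \<theta> * \<xi>$2, sin \<theta> * \<xi>$1 + cos \<theta> * \<xi>$2]"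

text \<open>Brings the rotated phase into the form of \<open>circle_integral_decay\<close>. The
  coefficients are the inner product and, up to sign, the determinant of \<open>x\<close> and
  \<open>\<xi>\<close>.\<close>

lemma inner_rot2: "x \<bullet> rot2 \<theta> \<xi> = (x \<bullet> \<xi>) * cos \<theta> + (x$2 * \<xi>$1 - x$1 * \<xi>$2) * sin \<theta>"
  by (simp add: inner_vec_def sum_2 rot2_def algebra_simps)

lemma norm_vec2_power2: "(norm (x::real^2))\<^sup>2 = (x$1)\<^sup>2 + (x$2)\<^sup>2"
  unfolding power2_norm_eq_inner by (simp add: inner_vec_def sum_2 power2_eq_square)

lemma norm_rot2 [simp]: "norm (rot2 \<theta> \<xi>) = norm \<xi>"
proof -
  have "(norm (rot2 \<theta> \<xi>))\<^sup>2 = ((cos \<theta>)\<^sup>2 + (sin \<theta>)\<^sup>2) * (norm \<xi>)\<^sup>2"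
    unfolding norm_vec2_power2 rot2_def vector_2 by algebra
  then show ?thesis by simp
qed

lemma orthogonal_transformation_rot2: "orthogonal_transformation (rot2 \<theta>)"
  unfolding orthogonal_transformation
proof
  show "linear (rot2 \<theta>)"
    by (rule linearI) (simp_all add: rot2_def vec_eq_iff forall_2 algebra_simps)
qed simp

lemma continuous_on_rot2: "continuous_on UNIV (\<lambda>(\<theta>, \<xi>). rot2 \<theta> \<xi>)"
proof -
  have "rot2 \<theta> \<xi> = (\<chi> i. if i = 1 then cos \<theta> * \<xi>$1 - sin \<theta> * \<xi>$2 else sin \<theta> * \<xi>$1 + cos \<theta> * \<xi>$2)" for \<theta> \<xi>
    by (simp add: vec_eq_iff rot2_def forall_2)
  moreover have "continuous_on UNIV (\<lambda>x. if i = 1 then cos (fst x) * (snd x)$1 - sin (fst x) * (snd x)$2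
      else sin (fst x) * (snd x)$1 + cos (fst x) * (snd x :: real^2)$2)" for i :: 2
    by (cases "i = 1") (auto intro!: continuous_intros)
  ultimately show ?thesis
    by (simp add: case_prod_beta continuous_on_vec_lambda)
qed

text \<open>\<open>h\<close> stands for the whole radial part of the integrand, oscillating factor
  included, so a supremum \<open>M\<close> is all that can be fixed independently of the phase.
  \<open>cont\<close> leaves out the origin, where \<open>g\<close> is arbitrary;
  \<open>supp\<close> together with \<open>A_pos\<close> gives \<open>h 0 = 0\<close>.\<close>

locale radial_cutoff =
  fixes h :: "real \<Rightarrow> complex" and A B M :: real
  assumes A_pos: "0 < A"
    and cont: "continuous_on {0<..} h"
    and supp: "\<And>r. 0 \<le> r \<Longrightarrow> r \<notin> {A..B} \<Longrightarrow> h r = 0"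
    and bound: "\<And>r. 0 \<le> r \<Longrightarrow> norm (h r) \<le> M"
begin

lemma M_nonneg: "M \<ge> 0"
  using bound[of 0] norm_ge_zero order_trans by blast

lemma measurable_wave [measurable]:
  "(\<lambda>\<xi>. cis (X \<bullet> \<xi>) * h (norm \<xi>)) \<in> borel_measurable borel" for X :: "'a::euclidean_space"
proof -
  \<comment> \<open>Off the origin the function is continuous and at the origin it vanishes, so the
    indicator changes nothing.\<close>
  have "(\<lambda>\<xi>::'a. indicator (-{0}) \<xi> *\<^sub>R (cis (X \<bullet> \<xi>) * h (norm \<xi>))) \<in> borel_measurable borel"
    by (intro borel_measurable_continuous_on_indicator continuous_intros continuous_on_compose2[OF cont])
      auto
  moreover have "indicator (-{0}) \<xi> *\<^sub>R (cis (X \<bullet> \<xi>) * h (norm \<xi>)) = cis (X \<bullet> \<xi>) * h (norm \<xi>)" for \<xi> :: 'a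
    using supp[of 0] A_pos by (cases "\<xi> = 0") auto
  ultimately show ?thesis by simp
qed

lemma wave_trivial_bound:
  fixes X :: "'a::euclidean_space"
  shows "norm (LINT \<xi>|lborel. cis (X \<bullet> \<xi>) * h (norm \<xi>)) \<le> M * measure lborel (cball (0::'a) B)"
proof -
  \<comment> \<open>The averaging lemma for a family that does not depend on its parameter.\<close>
  have "(1 - 0) * norm (LINT \<xi>|lborel. cis (X \<bullet> \<xi>) * h (norm \<xi>)) \<le> M * measure lborel (cball (0::'a) B)"
  proof (rule norm_integral_le_average[where G = "\<lambda>_ \<xi>. cis (X \<bullet> \<xi>) * h (norm \<xi>)"])
    show "(\<lambda>(\<theta>::real, \<xi>::'a). cis (X \<bullet> \<xi>) * h (norm \<xi>)) \<in> borel_measurable borel"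
      unfolding borel_prod[symmetric] by measurable
    show "norm (cis (X \<bullet> \<xi>) * h (norm \<xi>)) \<le> M" for \<xi>
      using bound by (simp add: norm_mult)
    show "norm (integral {0..1::real} (\<lambda>\<theta>. cis (X \<bullet> \<xi>) * h (norm \<xi>))) \<le> M" for \<xi>
      using bound by (simp add: norm_mult)
    show "cis (X \<bullet> \<xi>) * h (norm \<xi>) = 0" if "norm \<xi> > B" for \<xi>
      using supp[of "norm \<xi>"] that by simp
  qed auto
  then show ?thesis by simp
qed

text \<open>\<open>h\<close> is constant on circles, so the rotation averages the plane wave alone.
  The result is a Bessel function of \<open>norm X * norm \<xi>\<close>, and
  \<open>norm \<xi> \<ge> A\<close> on the support.\<close>

lemma wave_rotation_bound:
  fixes X :: "real^2"
  assumes C: "C \<ge> 0" "\<And>p q. p\<^sup>2 + q\<^sup>2 > 0 \<Longrightarrow>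
     norm (integral {0..2*pi} (\<lambda>\<theta>. cis (p * cos \<theta> + q * sin \<theta>))) \<le> C * sqrt (p\<^sup>2 + q\<^sup>2) powr (- 1 / 2)"
    and X: "X \<noteq> 0"
  shows "norm (LINT \<xi>|lborel. cis (X \<bullet> \<xi>) * h (norm \<xi>)) \<le>
    C * M * A powr (- 1 / 2) * measure lborel (cball (0::real^2) B) * norm X powr (- 1 / 2)"
proof -
  define I where "I = (LINT \<xi>|lborel. cis (X \<bullet> \<xi>) * h (norm \<xi>))"
  define L where "L = (C * M * A powr (- 1 / 2) * norm X powr (- 1 / 2)) * measure lborel (cball (0::real^2) B)"
  have "(2 * pi - 0) * norm I \<le> L"
    unfolding L_def
  proof (rule norm_integral_le_average[where G = "\<lambda>\<theta> \<xi>. cis (X \<bullet> rot2 \<theta> \<xi>) * h (norm (rot2 \<theta> \<xi>))"])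
    have "(\<lambda>x::real \<times> (real^2). case_prod rot2 x) \<in> borel_measurable borel"
      by (rule borel_measurable_continuous_onI) (rule continuous_on_rot2)
    from measurable_compose[OF this measurable_wave[of X]]
    show "(\<lambda>(\<theta>, \<xi>). cis (X \<bullet> rot2 \<theta> \<xi>) * h (norm (rot2 \<theta> \<xi>))) \<in> borel_measurable borel"
      by (simp add: case_prod_beta)
    show "(LINT \<xi>|lborel. cis (X \<bullet> rot2 \<theta> \<xi>) * h (norm (rot2 \<theta> \<xi>))) = I" for \<theta>
    proof -
      have [measurable]: "rot2 \<theta> \<in> borel_measurable borel"
        using orthogonal_transformation_linear[OF orthogonal_transformation_rot2]
        by (intro borel_measurable_continuous_onI linear_continuous_on linear_conv_bounded_linear[THEN iffD1])
      have "I = (LINT \<xi>|distr lborel borel (rot2 \<theta>). cis (X \<bullet> \<xi>) * h (norm \<xi>))"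
        unfolding I_def lborel_distr_orthogonal[OF orthogonal_transformation_rot2] ..
      also have "\<dots> = (LINT \<xi>|lborel. cis (X \<bullet> rot2 \<theta> \<xi>) * h (norm (rot2 \<theta> \<xi>)))"
        by (subst integral_distr) auto
      finally show ?thesis by simp
    qed
    show "norm (cis (X \<bullet> rot2 \<theta> \<xi>) * h (norm (rot2 \<theta> \<xi>))) \<le> M" for \<theta> \<xi>
      using bound by (simp add: norm_mult)
    show "cis (X \<bullet> rot2 \<theta> \<xi>) * h (norm (rot2 \<theta> \<xi>)) = 0" if "norm \<xi> > B" for \<theta> \<xi>
      using supp[of "norm \<xi>"] that by simp
    fix \<xi> :: "real^2"
    show "norm (integral {0..2 * pi} (\<lambda>\<theta>. cis (X \<bullet> rot2 \<theta> \<xi>) * h (norm (rot2 \<theta> \<xi>))))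
        \<le> C * M * A powr (- 1 / 2) * norm X powr (- 1 / 2)"
    proof (cases "norm \<xi> \<ge> A")
      case True
      define p q where "p = X \<bullet> \<xi>" and "q = X$2 * \<xi>$1 - X$1 * \<xi>$2"
      \<comment> \<open>Lagrange's identity: the squares of inner product and determinant add up to
        the product of the squared norms.\<close>
      have "p\<^sup>2 + q\<^sup>2 = (norm X)\<^sup>2 * (norm \<xi>)\<^sup>2"
        unfolding norm_vec2_power2 by (simp add: p_def q_def inner_vec_def sum_2 power2_eq_square algebra_simps)
      also have "\<dots> = (norm X * norm \<xi>)\<^sup>2" by (simp add: power_mult_distrib)
      finally have pq: "p\<^sup>2 + q\<^sup>2 = (norm X * norm \<xi>)\<^sup>2" .
      have pos: "norm X * norm \<xi> > 0" using True A_pos X by (intro mult_pos_pos) auto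
      have "norm (integral {0..2*pi} (\<lambda>\<theta>. cis (p * cos \<theta> + q * sin \<theta>))) \<le> C * (norm X * norm \<xi>) powr (- 1 / 2)"
      proof -
        have "sqrt (p\<^sup>2 + q\<^sup>2) = norm X * norm \<xi>"
          unfolding pq using pos by (simp only: real_sqrt_abs abs_of_pos)
        moreover have "p\<^sup>2 + q\<^sup>2 > 0"
          unfolding pq using pos by (rule zero_less_power)
        ultimately show ?thesis using C(2)[of p q] by simp
      qed
      also have "\<dots> = C * norm X powr (- 1 / 2) * norm \<xi> powr (- 1 / 2)" by (simp add: powr_mult)
      also have "\<dots> \<le> C * norm X powr (- 1 / 2) * A powr (- 1 / 2)"
        using True A_pos C by (intro mult_left_mono powr_mono2') auto
      finally have 1: "norm (integral {0..2*pi} (\<lambda>\<theta>. cis (p * cos \<theta> + q * sin \<theta>))) \<le> C * norm X powr (- 1 / 2) * A powr (- 1 / 2)" .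
      have "norm (integral {0..2 * pi} (\<lambda>\<theta>. cis (X \<bullet> rot2 \<theta> \<xi>) * h (norm (rot2 \<theta> \<xi>))))
          = norm (integral {0..2*pi} (\<lambda>\<theta>. cis (p * cos \<theta> + q * sin \<theta>))) * norm (h (norm \<xi>))"
        by (simp add: inner_rot2 p_def q_def norm_mult)
      also have "\<dots> \<le> (C * norm X powr (- 1 / 2) * A powr (- 1 / 2)) * M"
        using C by (intro mult_mono 1 bound) auto
      finally show ?thesis by (simp add: mult_ac)
    next
      case False
      then have "h (norm \<xi>) = 0" using supp by simp
      then show ?thesis using C M_nonneg by simp
    qed
  qed auto
  then have "norm I \<le> L / (2 * pi)"
    by (simp add: field_simps)
  also have "\<dots> \<le> L / 1"
    using C M_nonneg pi_gt3 by (intro divide_left_mono) (auto simp: L_def)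
  finally show ?thesis by (simp add: I_def L_def mult_ac)
qed

text \<open>On the ray through \<open>\<xi>\<close> the plane wave has the linear phase
  \<open>\<mu> * r\<close>, where \<open>\<mu>\<close> is the inner product of \<open>X\<close> with
  the unit vector in that direction. The weight \<open>r^2\<close>, instead of the \<open>r\<close>
  of polar coordinates, is the Jacobian \<open>\<rho>^2\<close> of the planar dilation expressed in
  \<open>r = \<rho> * norm \<xi>\<close>.\<close>

lemma wave_dilation_bound:
  fixes X :: "real^2"
  assumes K: "\<And>\<mu> u v. \<bar>\<mu>\<bar> \<le> norm X \<Longrightarrow> A \<le> u \<Longrightarrow> u \<le> v \<Longrightarrow> v \<le> B \<Longrightarrow>
      norm (integral {u..v} (\<lambda>r. cis (\<mu> * r) * h r * of_real (r\<^sup>2))) \<le> K"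
    and K0: "K \<ge> 0"
  shows "norm (LINT \<xi>|lborel. cis (X \<bullet> \<xi>) * h (norm \<xi>)) \<le> K * (2 / A) ^ 3 * measure lborel (cball (0::real^2) B)"
proof -
  define I where "I = (LINT \<xi>|lborel. cis (X \<bullet> \<xi>) * h (norm \<xi>))"
  have "(2 - 1) * norm I \<le> K * (2 / A) ^ 3 * measure lborel (cball (0::real^2) B)"
  proof (rule norm_integral_le_average[where G = "\<lambda>\<rho> \<xi>. \<rho>\<^sup>2 *\<^sub>R (cis (X \<bullet> (\<rho> *\<^sub>R \<xi>)) * h (norm (\<rho> *\<^sub>R \<xi>)))"])
    have "(\<lambda>x::real \<times> (real^2). fst x *\<^sub>R snd x) \<in> borel_measurable borel"
      by (intro borel_measurable_continuous_onI continuous_intros)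
    from measurable_compose[OF this measurable_wave[of X]]
    have [measurable]: "(\<lambda>x. cis (X \<bullet> (fst x *\<^sub>R snd x)) * h (norm (fst x *\<^sub>R snd x))) \<in> borel_measurable borel" .
    have [measurable]: "(\<lambda>x::real \<times> (real^2). (fst x)\<^sup>2) \<in> borel_measurable borel"
      by (intro borel_measurable_continuous_onI continuous_intros)
    have "(\<lambda>x::real \<times> (real^2). (fst x)\<^sup>2 *\<^sub>R (cis (X \<bullet> (fst x *\<^sub>R snd x)) * h (norm (fst x *\<^sub>R snd x)))) \<in> borel_measurable borel"
      by measurable
    then show "(\<lambda>(\<rho>, \<xi>). \<rho>\<^sup>2 *\<^sub>R (cis (X \<bullet> (\<rho> *\<^sub>R \<xi>)) * h (norm (\<rho> *\<^sub>R \<xi>)))) \<in> borel_measurable borel"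
      by (simp add: case_prod_beta)
    show "(LINT \<xi>|lborel. \<rho>\<^sup>2 *\<^sub>R (cis (X \<bullet> (\<rho> *\<^sub>R \<xi>)) * h (norm (\<rho> *\<^sub>R \<xi>)))) = I" if "\<rho> \<in> {1..2}" for \<rho>
      using lborel_integral_scaleR[OF measurable_wave[of X], of \<rho>] that by (simp add: I_def)
    show "norm (\<rho>\<^sup>2 *\<^sub>R (cis (X \<bullet> (\<rho> *\<^sub>R \<xi>)) * h (norm (\<rho> *\<^sub>R \<xi>)))) \<le> 2\<^sup>2 * M" if "\<rho> \<in> {1..2}" for \<rho> \<xi>
      unfolding norm_scaleR norm_mult norm_cis using that bound[of "norm (\<rho> *\<^sub>R \<xi>)"] M_nonneg
      by (intro mult_mono) (auto intro: power_mono[of _ 2 2, simplified])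
    show "\<rho>\<^sup>2 *\<^sub>R (cis (X \<bullet> (\<rho> *\<^sub>R \<xi>)) * h (norm (\<rho> *\<^sub>R \<xi>))) = 0" if "\<rho> \<in> {1..2}" "norm \<xi> > B" for \<rho> \<xi>
    proof -
      have "norm (\<rho> *\<^sub>R \<xi>) \<ge> 1 * norm \<xi>" using that unfolding norm_scaleR by (intro mult_right_mono) auto
      with that(2) have "norm (\<rho> *\<^sub>R \<xi>) > B" by simp
      then have "h (norm (\<rho> *\<^sub>R \<xi>)) = 0" by (intro supp) auto
      then show ?thesis by simp
    qed
    fix \<xi> :: "real^2"
    show "norm (integral {1..2} (\<lambda>\<rho>. \<rho>\<^sup>2 *\<^sub>R (cis (X \<bullet> (\<rho> *\<^sub>R \<xi>)) * h (norm (\<rho> *\<^sub>R \<xi>))))) \<le> K * (2 / A) ^ 3"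
    proof (cases "\<xi> = 0")
      case True
      then show ?thesis using K0 A_pos supp[of 0] by simp
    next
      case False
      define c where "c = norm \<xi>"
      have c: "c > 0" using False by (simp add: c_def)
      define \<mu> where "\<mu> = X \<bullet> \<xi> / c"
      have \<mu>: "\<bar>\<mu>\<bar> \<le> norm X"
        using Cauchy_Schwarz_ineq2[of X \<xi>] c by (simp add: \<mu>_def c_def abs_divide field_simps)
      define H where "H r = cis (\<mu> * r) * h r * of_real (r\<^sup>2)" for r
      have cH: "continuous_on {c..2*c} H"
        unfolding H_def using c by (intro continuous_intros continuous_on_subset[OF cont]) auto
      have "(H has_integral integral {c..2*c} H) (cbox c (2*c))"
        unfolding cbox_interval by (intro integrable_integral integrable_continuous_real cH)
      from has_integral_affinity[OF this, of c 0]
      have "((\<lambda>\<rho>. H (c * \<rho>)) has_integral (1 / c) *\<^sub>R integral {c..2*c} H) {1..2}"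
        using c by simp
      from has_integral_cmul[OF this, of "1 / c\<^sup>2"]
      have "((\<lambda>\<rho>. (1 / c\<^sup>2) *\<^sub>R H (c * \<rho>)) has_integral (1 / c ^ 3) *\<^sub>R integral {c..2*c} H) {1..2}"
        by (simp add: power2_eq_square power3_eq_cube)
      moreover have "(1 / c\<^sup>2) *\<^sub>R H (c * \<rho>) = \<rho>\<^sup>2 *\<^sub>R (cis (X \<bullet> (\<rho> *\<^sub>R \<xi>)) * h (norm (\<rho> *\<^sub>R \<xi>)))"
        if "\<rho> \<in> {1..2}" for \<rho>
      proof -
        have "\<mu> * (c * \<rho>) = X \<bullet> (\<rho> *\<^sub>R \<xi>)" using c by (simp add: \<mu>_def)
        moreover have "norm (\<rho> *\<^sub>R \<xi>) = c * \<rho>" using that by (simp add: c_def)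
        ultimately show ?thesis using c
          by (simp add: H_def scaleR_conv_of_real power_mult_distrib)
      qed
      ultimately have "((\<lambda>\<rho>. \<rho>\<^sup>2 *\<^sub>R (cis (X \<bullet> (\<rho> *\<^sub>R \<xi>)) * h (norm (\<rho> *\<^sub>R \<xi>)))) has_integral (1 / c ^ 3) *\<^sub>R integral {c..2*c} H) {1..2}"
        using has_integral_cong by (smt (verit, best))
      then have "norm (integral {1..2} (\<lambda>\<rho>. \<rho>\<^sup>2 *\<^sub>R (cis (X \<bullet> (\<rho> *\<^sub>R \<xi>)) * h (norm (\<rho> *\<^sub>R \<xi>)))))
          = 1 / c ^ 3 * norm (integral {c..2*c} H)"
        using c by (simp add: integral_unique)
      \<comment> \<open>The substitution produced \<open>1 / c ^ 3\<close>, two powers from the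
        weight and one from the differential. The intersection is nonempty only if
        \<open>c \<ge> A / 2\<close>, which bounds this by \<open>(2 / A) ^ 3\<close>.\<close>
      also have "integral {c..2*c} H = integral ({c..2*c} \<inter> {A..B}) H"
      proof -
        have "integral {c..2*c} H = integral {c..2*c} (\<lambda>r. if r \<in> {A..B} then H r else 0)"
          using supp c by (intro Henstock_Kurzweil_Integration.integral_cong) (auto simp: H_def)
        also have "\<dots> = integral ({A..B} \<inter> {c..2*c}) H"
          by (rule integral_restrict_Int)
        finally show ?thesis by (simp only: Int_commute)
      qed
      also have "1 / c ^ 3 * norm (integral ({c..2*c} \<inter> {A..B}) H) \<le> (2 / A) ^ 3 * K"
      proof (cases "max c A \<le> min (2*c) B")
        case True
        then have "A \<le> 2 * c" by auto
        have "1 / c \<le> 2 / A" using \<open>A \<le> 2 * c\<close> c A_pos by (simp add: field_simps)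
        then have "(1 / c) ^ 3 \<le> (2 / A) ^ 3" using c by (intro power_mono) auto
        moreover have "norm (integral ({c..2*c} \<inter> {A..B}) H) \<le> K"
          unfolding H_def Int_atLeastAtMost using True by (intro K \<mu>) auto
        ultimately show ?thesis
          using A_pos c by (intro mult_mono) (auto simp: power_divide)
      next
        case False
        then have "{c..2*c} \<inter> {A..B} = {}" by auto
        then show ?thesis using K0 A_pos by simp
      qed
      finally show ?thesis by (simp add: mult.commute)
    qed
  qed auto
  then show ?thesis by (simp add: I_def)
qed

end

section \<open>Oscillatory integrals with an annular amplitude\<close>

text \<open>The derivative witnessing \<open>Cn_on\<close> agrees with \<open>deriv g\<close> only
  on \<open>S\<close>; as \<open>S\<close> is open, the class can still be transferred from one to
  the other.\<close>

lemma Cn_on_cong: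
  assumes "open S" "\<And>x. x \<in> S \<Longrightarrow> f x = g x" "Cn_on n S f"
  shows "Cn_on n S g"
proof (cases n)
  case 0
  then show ?thesis using assms continuous_on_cong[of S S f g] by simp
next
  case (Suc m)
  with assms obtain f' where "\<And>x. x \<in> S \<Longrightarrow> (f has_vector_derivative f' x) (at x)" "Cn_on m S f'"
    by auto
  moreover have "(g has_vector_derivative f' x) (at x)" if "x \<in> S" for x
    using calculation(1)[OF that] assms(1,2) that
    by (metis has_vector_derivative_transform_within_open)
  ultimately show ?thesis using Suc by auto
qed

lemma Cn_on_imp_derivs:
  fixes g :: "real \<Rightarrow> real"
  assumes "Cn_on n S g" "open S"
  shows "(\<forall>p<n. \<forall>x\<in>S. ((deriv ^^ p) g has_real_derivative (deriv ^^ Suc p) g x) (at x))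
    \<and> continuous_on S ((deriv ^^ n) g)"
  using assms(1)
proof (induction n arbitrary: g)
  case 0
  then show ?case by simp
next
  case (Suc n)
  then obtain f' where f': "\<And>x. x \<in> S \<Longrightarrow> (g has_real_derivative f' x) (at x)" "Cn_on n S f'"
    unfolding Cn_on.simps has_real_derivative_iff_has_vector_derivative by blast
  have d: "deriv g x = f' x" if "x \<in> S" for x
    using f'(1)[OF that] by (rule DERIV_imp_deriv)
  then have "Cn_on n S (deriv g)"
    using Cn_on_cong[OF assms(2) _ f'(2), of "deriv g"] by simp
  from Suc.IH[OF this]
  have IH: "\<And>p x. p < n \<Longrightarrow> x \<in> S \<Longrightarrow> ((deriv ^^ Suc p) g has_real_derivative (deriv ^^ Suc (Suc p)) g x) (at x)"
    "continuous_on S ((deriv ^^ Suc n) g)"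
    by (simp_all only: funpow_Suc_right o_apply)
  have "((deriv ^^ p) g has_real_derivative (deriv ^^ Suc p) g x) (at x)" if "p < Suc n" "x \<in> S" for p x
  proof (cases p)
    case 0
    then show ?thesis using f'(1)[OF that(2)] d[OF that(2)] by simp
  next
    case (Suc q)
    then show ?thesis using IH(1)[of q x] that by simp
  qed
  then show ?case using IH(2) by blast
qed

text \<open>One continuous derivative is what an integration by parts against the amplitude takes.
  The amplitude is evaluated at norms, so \<open>supp\<close> speaks of \<open>0 \<le> y\<close>
  only, which admits even cutoffs.\<close>

locale annular_amplitude =
  fixes a a' :: "real \<Rightarrow> complex" and A B :: real
  assumes A_pos: "0 < A"
    and deriv: "\<And>y. (a has_vector_derivative a' y) (at y)"
    and cont': "continuous_on UNIV a'"
    and supp: "\<And>y. 0 \<le> y \<Longrightarrow> y \<notin> {A..B} \<Longrightarrow> a y = 0"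
begin

lemma cont: "continuous_on S a"
  using has_vector_derivative_continuous[OF deriv] by (meson continuous_at_imp_continuous_on)

definition wave :: "real \<Rightarrow> (real \<Rightarrow> real) \<Rightarrow> real \<Rightarrow> real \<Rightarrow> complex" where
  "wave s g T r = cis (T * g r) * a r * of_real (r powr s)"

lemma bounded_on_annulus:
  fixes f :: "real \<Rightarrow> complex"
  assumes "continuous_on {A..B} f"
  obtains M where "M \<ge> 0" "\<And>r. r \<in> {A..B} \<Longrightarrow> norm (f r) \<le> M"
proof -
  have "bounded (f ` {A..B})"
    by (intro compact_imp_bounded compact_continuous_image assms) auto
  then obtain M where "\<And>r. r \<in> {A..B} \<Longrightarrow> norm (f r) \<le> M"
    unfolding bounded_iff by blast
  then have "\<And>r. r \<in> {A..B} \<Longrightarrow> norm (f r) \<le> max M 0" by fastforce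
  then show ?thesis using that[of "max M 0"] by simp
qed

text \<open>\<open>cis\<close> has modulus 1, so the bound comes from \<open>a\<close> and the power
  alone. Hence \<open>M\<close> can be chosen before \<open>g\<close> and \<open>T\<close>, as
  uniformity in \<open>t\<close> and \<open>\<delta>\<close> demands.\<close>

lemma wave_cutoff:
  obtains M where "M \<ge> 0" "\<And>g T. continuous_on {0<..} g \<Longrightarrow> radial_cutoff (wave s g T) A B M"
proof -
  have "continuous_on {A..B} (\<lambda>r. a r * of_real (r powr s))"
    using A_pos by (intro continuous_intros cont) auto
  then obtain M where M: "M \<ge> 0" "\<And>r. r \<in> {A..B} \<Longrightarrow> norm (a r * of_real (r powr s)) \<le> M"
    by (rule bounded_on_annulus) blast
  have "radial_cutoff (wave s g T) A B M" if g: "continuous_on {0<..} g" for g T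
  proof
    show "continuous_on {0<..} (wave s g T)"
      unfolding wave_def[abs_def] by (intro continuous_intros cont g) auto
    show zero: "wave s g T r = 0" if "0 \<le> r" "r \<notin> {A..B}" for r
      using supp[OF that] by (simp add: wave_def)
    show "norm (wave s g T r) \<le> M" if "0 \<le> r" for r
    proof (cases "r \<in> {A..B}")
      case True
      then show ?thesis using M(2)[OF True] by (simp add: wave_def norm_mult)
    next
      case False
      then show ?thesis using zero[OF that] M(1) by simp
    qed
  qed (fact A_pos)
  with M(1) show ?thesis by (rule that)
qed

text \<open>Rescaling \<open>\<xi>\<close> by \<open>\<delta>\<close> yields
  \<open>\<delta> powr (- 2)\<close> from the area and \<open>\<delta> powr (- s)\<close> from the
  power of the norm.\<close>

lemma osc_integral_eq:
  assumes \<delta>: "\<delta> > 0" and g: "continuous_on {0<..} g"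
  shows "osc_integral a g s \<delta> t x = of_real (\<delta> powr (- (s + 2))) *
    (LINT \<xi>|lborel. cis ((x /\<^sub>R \<delta>) \<bullet> \<xi>) * wave s g (t / \<delta>) (norm \<xi>))"
proof -
  obtain M where "radial_cutoff (wave s g (t / \<delta>)) A B M" using wave_cutoff g by metis
  then interpret radial_cutoff "wave s g (t / \<delta>)" A B M .
  have eq: "exp (\<i> * complex_of_real (x \<bullet> \<xi>)) * exp (\<i> * complex_of_real (t / \<delta> * g (\<delta> * norm \<xi>)))
        * a (\<delta> * norm \<xi>) * complex_of_real (norm \<xi> powr s)
     = of_real (\<delta> powr (- s)) * (cis ((x /\<^sub>R \<delta>) \<bullet> (\<delta> *\<^sub>R \<xi>)) * wave s g (t / \<delta>) (norm (\<delta> *\<^sub>R \<xi>)))" for \<xi>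
  proof -
    have "norm \<xi> powr s = \<delta> powr (- s) * (\<delta> * norm \<xi>) powr s"
      using \<delta> by (simp add: powr_mult powr_minus)
    moreover have "(x /\<^sub>R \<delta>) \<bullet> (\<delta> *\<^sub>R \<xi>) = x \<bullet> \<xi>" using \<delta> by simp
    ultimately show ?thesis using \<delta> by (simp only: wave_def cis_conv_exp norm_scaleR abs_of_pos of_real_mult mult_ac)
  qed
  have "(LINT \<xi>|lborel. cis ((x /\<^sub>R \<delta>) \<bullet> (\<delta> *\<^sub>R \<xi>)) * wave s g (t / \<delta>) (norm (\<delta> *\<^sub>R \<xi>)))
      = of_real (\<delta> powr (- 2)) * (LINT \<xi>|lborel. cis ((x /\<^sub>R \<delta>) \<bullet> \<xi>) * wave s g (t / \<delta>) (norm \<xi>))"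
    unfolding lborel_integral_scaleR[OF measurable_wave[of "x /\<^sub>R \<delta>"] \<delta>]
    using \<delta> by (simp add: scaleR_conv_of_real powr_minus divide_simps flip: of_real_power)
  moreover have "\<delta> powr (- (s + 2)) = \<delta> powr (- s) * \<delta> powr (- 2)"
    by (simp flip: powr_add)
  ultimately show ?thesis
    unfolding osc_integral_def eq by simp
qed

text \<open>The power \<open>r powr s\<close> and the weight \<open>r^2\<close> join the cutoff in
  one differentiable amplitude \<open>b\<close> on an interval away from 0. What remains to be
  estimated is the bare phase, and the factor \<open>C\<close> knows neither \<open>g\<close> nor
  \<open>T\<close> nor \<open>\<mu>\<close>.\<close>

lemma amplitude_radial:
  obtains C where "C \<ge> 0"
    "\<And>g T K \<mu> u v. continuous_on {0<..} g \<Longrightarrow> A \<le> u \<Longrightarrow> u \<le> v \<Longrightarrow> v \<le> B \<Longrightarrow>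
      (\<And>r. r \<in> {u..v} \<Longrightarrow> norm (integral {u..r} (\<lambda>r. cis (\<mu> * r + T * g r))) \<le> K) \<Longrightarrow>
      norm (integral {u..v} (\<lambda>r. cis (\<mu> * r) * wave s g T r * of_real (r\<^sup>2))) \<le> C * K"
proof -
  define b where "b r = a r * of_real (r powr (s + 2))" for r
  define b' where "b' r = a r * of_real ((s + 2) * r powr (s + 1)) + a' r * of_real (r powr (s + 2))" for r
  have db: "(b has_vector_derivative b' r) (at r)" if "r > 0" for r
  proof -
    have "((\<lambda>r. r powr (s + 2)) has_real_derivative (s + 2) * r powr (s + 1)) (at r)"
      using that by (auto intro!: derivative_eq_intros simp: algebra_simps)
    from has_vector_derivative_mult[OF deriv has_vector_derivative_of_real[OF this]]
    show ?thesis unfolding b_def[abs_def] b'_def by simp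
  qed
  have cb': "continuous_on {A..B} b'"
    unfolding b'_def[abs_def] using A_pos
    by (intro continuous_intros cont continuous_on_subset[OF cont']) auto
  have "continuous_on {A..B} b"
    unfolding b_def[abs_def] using A_pos by (intro continuous_intros cont) auto
  then obtain M where M: "M \<ge> 0" "\<And>r. r \<in> {A..B} \<Longrightarrow> norm (b r) \<le> M"
    by (rule bounded_on_annulus) blast
  obtain M' where M': "M' \<ge> 0" "\<And>r. r \<in> {A..B} \<Longrightarrow> norm (b' r) \<le> M'"
    using cb' by (rule bounded_on_annulus) blast
  define C where "C = M + \<bar>B - A\<bar> * M'"
  have "norm (integral {u..v} (\<lambda>r. cis (\<mu> * r) * wave s g T r * of_real (r\<^sup>2))) \<le> C * K"
    if g: "continuous_on {0<..} g" and uv: "A \<le> u" "u \<le> v" "v \<le> B"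
      and K: "\<And>r. r \<in> {u..v} \<Longrightarrow> norm (integral {u..r} (\<lambda>r. cis (\<mu> * r + T * g r))) \<le> K" for g T K \<mu> u v
  proof -
    have "K \<ge> 0" using K[of u] uv by auto
    have "cis (\<mu> * r) * wave s g T r * of_real (r\<^sup>2) = cis (\<mu> * r + T * g r) * b r" if "r \<in> {u..v}" for r
    proof -
      have "r powr (s + 2) = r powr s * r\<^sup>2"
        using that uv A_pos by (simp add: powr_add)
      then show ?thesis by (simp add: wave_def b_def cis_mult[symmetric] del: of_real_power)
    qed
    then have "integral {u..v} (\<lambda>r. cis (\<mu> * r) * wave s g T r * of_real (r\<^sup>2)) = integral {u..v} (\<lambda>r. cis (\<mu> * r + T * g r) * b r)"
      by (intro Henstock_Kurzweil_Integration.integral_cong) auto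
    also have "norm \<dots> \<le> K * (M + (v - u) * M')"
    proof (rule oscillatory_amplitude[OF K])
      show "continuous_on {u..v} (\<lambda>r. \<mu> * r + T * g r)"
        using uv A_pos by (intro continuous_intros continuous_on_subset[OF g]) auto
      show "(b has_vector_derivative b' r) (at r within {u..v})" if "r \<in> {u..v}" for r
        using db[of r] that uv A_pos by (auto intro: has_vector_derivative_at_within)
      show "continuous_on {u..v} b'" using uv by (intro continuous_on_subset[OF cb']) auto
    qed (use M M' uv in auto)
    also have "\<dots> \<le> K * C"
      unfolding C_def using \<open>K \<ge> 0\<close> M' uv by (intro mult_left_mono add_mono mult_right_mono) auto
    finally show ?thesis by (simp add: mult.commute)
  qed
  moreover have "C \<ge> 0" using M M' by (simp add: C_def)
  ultimately show ?thesis using that by blast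
qed

text \<open>Reduces the planar bound to a one-dimensional one, with a single constant for all
  \<open>g\<close>. The size \<open>\<tau>\<close> of the phase is kept apart from
  \<open>\<bar>t / \<delta>\<bar>\<close> because a phase dilated by \<open>2^k\<close> has size
  \<open>2^k * \<bar>t / \<delta>\<bar>\<close>.\<close>

lemma osc_integral_bound:
  fixes l :: nat and c K :: real
  assumes c: "c > 0" and K: "K \<ge> 0" and l: "l \<ge> 2"
  obtains C where "C \<ge> 0"
    "\<And>g \<delta> t \<tau> x. \<delta> > 0 \<Longrightarrow> \<tau> > 0 \<Longrightarrow> continuous_on {0<..} g \<Longrightarrow>
      (\<And>\<mu> u v. 1 \<le> \<tau> \<Longrightarrow> \<bar>\<mu>\<bar> \<le> c * \<tau> \<Longrightarrow> A \<le> u \<Longrightarrow> u \<le> v \<Longrightarrow> v \<le> B \<Longrightarrow>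
        norm (integral {u..v} (\<lambda>r. cis (\<mu> * r + t / \<delta> * g r))) \<le> K * \<tau> powr (- 1 / real l)) \<Longrightarrow>
      norm (osc_integral a g s \<delta> t x) \<le> C * \<delta> powr (- (s + 2)) * \<tau> powr (- 1 / real l)"
proof -
  obtain M where M: "M \<ge> 0" and rc: "\<And>g T. continuous_on {0<..} g \<Longrightarrow> radial_cutoff (wave s g T) A B M"
    using wave_cutoff[of s] by blast
  obtain N where N: "N \<ge> 0" and amp:
    "\<And>g T K \<mu> u v. continuous_on {0<..} g \<Longrightarrow> A \<le> u \<Longrightarrow> u \<le> v \<Longrightarrow> v \<le> B \<Longrightarrow>
      (\<And>r. r \<in> {u..v} \<Longrightarrow> norm (integral {u..r} (\<lambda>r. cis (\<mu> * r + T * g r))) \<le> K) \<Longrightarrow>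
      norm (integral {u..v} (\<lambda>r. cis (\<mu> * r) * wave s g T r * of_real (r\<^sup>2))) \<le> N * K"
    using amplitude_radial[of s] by blast
  obtain J where J: "J \<ge> 0" "\<And>p q. p\<^sup>2 + q\<^sup>2 > 0 \<Longrightarrow>
     norm (integral {0..2*pi} (\<lambda>\<theta>. cis (p * cos \<theta> + q * sin \<theta>))) \<le> J * sqrt (p\<^sup>2 + q\<^sup>2) powr (- 1 / 2)"
    using circle_integral_decay by blast
  define V where "V = measure lborel (cball (0::real^2) B)"
  have V: "V \<ge> 0" by (simp add: V_def)
  define C1 C2 C3 where "C1 = M * V" and "C2 = J * M * A powr (- 1 / 2) * V * c powr (- 1 / 2)"
    and "C3 = N * K * (2 / A) ^ 3 * V"
  have C: "C1 \<ge> 0" "C2 \<ge> 0" "C3 \<ge> 0"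
    using M V J N K A_pos by (simp_all add: C1_def C2_def C3_def)
  show ?thesis
  proof (rule that[of "C1 + C2 + C3"])
    show "C1 + C2 + C3 \<ge> 0" using C by simp
    fix g \<delta> t \<tau> and x :: "real^2"
    assume \<delta>: "\<delta> > 0" and \<tau>: "\<tau> > 0" and g: "continuous_on {0<..} g"
      and osc: "\<And>\<mu> u v. 1 \<le> \<tau> \<Longrightarrow> \<bar>\<mu>\<bar> \<le> c * \<tau> \<Longrightarrow> A \<le> u \<Longrightarrow> u \<le> v \<Longrightarrow> v \<le> B \<Longrightarrow>
        norm (integral {u..v} (\<lambda>r. cis (\<mu> * r + t / \<delta> * g r))) \<le> K * \<tau> powr (- 1 / real l)"
    interpret radial_cutoff "wave s g (t / \<delta>)" A B M by (rule rc[OF g])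
    define X where "X = x /\<^sub>R \<delta>"
    define W where "W = (LINT \<xi>|lborel. cis (X \<bullet> \<xi>) * wave s g (t / \<delta>) (norm \<xi>))"
    define \<epsilon> where "\<epsilon> = \<tau> powr (- 1 / real l)"
    have \<epsilon>: "\<epsilon> \<ge> 0" by (simp add: \<epsilon>_def)
    have "norm W \<le> (C1 + C2 + C3) * \<epsilon>"
    proof -
      \<comment> \<open>Small phase, dominant plane wave, dominant radial phase. The threshold
        \<open>c\<close> is the tolerance for linear perturbations granted by
        \<open>osc\<close>.\<close>
      consider "\<tau> < 1" | "\<tau> \<ge> 1" "norm X > c * \<tau>" | "\<tau> \<ge> 1" "norm X \<le> c * \<tau>" by linarith
      then show ?thesis
      proof cases
        case 1
        have "\<tau> powr (1 / real l) \<le> 1" using 1 \<tau> by (intro powr_le1) auto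
        then have "1 \<le> \<epsilon>" using \<tau> by (simp add: \<epsilon>_def powr_minus_divide)
        have "norm W \<le> C1 * 1"
          using wave_trivial_bound[of X] by (simp add: W_def C1_def V_def)
        also have "\<dots> \<le> C1 * \<epsilon>" using C \<open>1 \<le> \<epsilon>\<close> by (intro mult_left_mono) auto
        also have "\<dots> \<le> (C1 + C2 + C3) * \<epsilon>" using C \<epsilon> by (intro mult_right_mono) auto
        finally show ?thesis .
      next
        case 2
        then have "X \<noteq> 0" using c \<tau> by (metis mult_pos_pos norm_zero not_less_iff_gr_or_eq)
        have "norm X powr (- 1 / 2) \<le> (c * \<tau>) powr (- 1 / 2)"
          using 2 c \<tau> by (intro powr_mono2') auto
        also have "\<dots> = c powr (- 1 / 2) * \<tau> powr (- 1 / 2)" by (rule powr_mult)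
        \<comment> \<open>Here \<open>l \<ge> 2\<close> enters: the exponent -1/2 is at most -1/l,
          and \<open>\<tau> \<ge> 1\<close>.\<close>
        also have "\<dots> \<le> c powr (- 1 / 2) * \<epsilon>"
          unfolding \<epsilon>_def using 2 l by (intro mult_left_mono powr_mono) (auto simp: field_simps)
        finally have 3: "norm X powr (- 1 / 2) \<le> c powr (- 1 / 2) * \<epsilon>" .
        have "norm W \<le> J * M * A powr (- 1 / 2) * V * norm X powr (- 1 / 2)"
          unfolding W_def V_def by (rule wave_rotation_bound[OF J \<open>X \<noteq> 0\<close>])
        also have "\<dots> \<le> J * M * A powr (- 1 / 2) * V * (c powr (- 1 / 2) * \<epsilon>)"
          using J M V by (intro mult_left_mono 3) auto
        also have "\<dots> = C2 * \<epsilon>" by (simp add: C2_def)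
        also have "\<dots> \<le> (C1 + C2 + C3) * \<epsilon>" using C \<epsilon> by (intro mult_right_mono) auto
        finally show ?thesis .
      next
        case 3
        have "norm W \<le> N * (K * \<epsilon>) * (2 / A) ^ 3 * V"
          unfolding W_def V_def
        proof (rule wave_dilation_bound)
          show "0 \<le> N * (K * \<epsilon>)" using N K \<epsilon> by simp
          fix \<mu> u v assume *: "\<bar>\<mu>\<bar> \<le> norm X" "A \<le> u" "u \<le> v" "v \<le> B"
          show "norm (integral {u..v} (\<lambda>r. cis (\<mu> * r) * wave s g (t / \<delta>) r * of_real (r\<^sup>2))) \<le> N * (K * \<epsilon>)"
            unfolding \<epsilon>_def using * 3 by (intro amp g osc) auto
        qed
        also have "\<dots> = C3 * \<epsilon>" by (simp add: C3_def)
        also have "\<dots> \<le> (C1 + C2 + C3) * \<epsilon>" using C \<epsilon> by (intro mult_right_mono) auto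
        finally show ?thesis .
      qed
    qed
    then have "\<delta> powr (- (s + 2)) * norm W \<le> \<delta> powr (- (s + 2)) * ((C1 + C2 + C3) * \<epsilon>)"
      by (intro mult_left_mono) auto
    then show "norm (osc_integral a g s \<delta> t x) \<le> (C1 + C2 + C3) * \<delta> powr (- (s + 2)) * \<tau> powr (- 1 / real l)"
      unfolding osc_integral_eq[OF \<delta> g] norm_mult by (simp add: W_def X_def \<epsilon>_def mult_ac)
  qed
qed

text \<open>Takes \<open>\<tau> = \<bar>t / \<delta>\<bar>\<close> and the iterated derivatives of
  \<open>g\<close> as the family of derivatives. The factor \<open>\<delta> powr (1 / l)\<close>
  contained in the power of \<open>\<tau>\<close> turns \<open>s + 2\<close> into
  \<open>s + 2 - 1 / l\<close>.\<close>

lemma osc_integral_finite_type: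
  fixes g :: "real \<Rightarrow> real"
  assumes AB: "A \<le> B" and l: "l \<ge> 2" and lam: "lam > 0" and g: "Cn_on l {0<..} g"
    and low: "\<And>r. r \<in> {A..B} \<Longrightarrow> (\<Sum>p=1..l. \<bar>(deriv ^^ p) g r\<bar>) \<ge> lam"
  shows "\<exists>C\<ge>0. \<forall>t \<delta> x. t \<noteq> 0 \<longrightarrow> \<delta> > 0 \<longrightarrow>
    norm (osc_integral a g s \<delta> t x) \<le> C * \<delta> powr (- (s + 2 - 1 / real l)) / \<bar>t\<bar> powr (1 / real l)"
proof -
  have D: "((deriv ^^ p) g has_real_derivative (deriv ^^ Suc p) g x) (at x)" if "p < l" "x > 0" for p x
    using Cn_on_imp_derivs[OF g] that by simp
  have "continuous_on {0<..} ((deriv ^^ l) g)" using Cn_on_imp_derivs[OF g] by simp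
  then have cl: "continuous_on {A..B} ((deriv ^^ l) g)"
    using A_pos by (auto intro: continuous_on_subset)
  have cg: "continuous_on {0<..} g"
    using D[of 0] l by (intro DERIV_continuous_on) (auto intro: has_field_derivative_at_within)
  have "\<exists>c>0. \<exists>C\<ge>0. \<forall>T \<mu> u v. 1 \<le> \<bar>T\<bar> \<longrightarrow> \<bar>\<mu>\<bar> \<le> c * \<bar>T\<bar> \<longrightarrow> A \<le> u \<longrightarrow> u \<le> v \<longrightarrow> v \<le> B \<longrightarrow>
    norm (integral {u..v} (\<lambda>x. cis (\<mu> * x + T * (deriv ^^ 0) g x))) \<le> C * \<bar>T\<bar> powr (- 1 / real l)"
  proof (rule van_der_corput_finite_type[OF AB l lam _ cl low])
    fix p x assume "p < l" "x \<in> {A..B}"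
    then show "((deriv ^^ p) g has_real_derivative (deriv ^^ Suc p) g x) (at x within {A..B})"
      using A_pos by (intro has_field_derivative_at_within[OF D]) auto
  qed
  then obtain c K where c: "c > 0" and K: "K \<ge> 0" and osc: "\<And>T \<mu> u v. 1 \<le> \<bar>T\<bar> \<Longrightarrow> \<bar>\<mu>\<bar> \<le> c * \<bar>T\<bar> \<Longrightarrow>
    A \<le> u \<Longrightarrow> u \<le> v \<Longrightarrow> v \<le> B \<Longrightarrow>
    norm (integral {u..v} (\<lambda>x. cis (\<mu> * x + T * g x))) \<le> K * \<bar>T\<bar> powr (- 1 / real l)"
    by auto
  obtain C where C: "C \<ge> 0" and bound:
    "\<And>g \<delta> t \<tau> x. \<delta> > 0 \<Longrightarrow> \<tau> > 0 \<Longrightarrow> continuous_on {0<..} g \<Longrightarrow>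
      (\<And>\<mu> u v. 1 \<le> \<tau> \<Longrightarrow> \<bar>\<mu>\<bar> \<le> c * \<tau> \<Longrightarrow> A \<le> u \<Longrightarrow> u \<le> v \<Longrightarrow> v \<le> B \<Longrightarrow>
        norm (integral {u..v} (\<lambda>r. cis (\<mu> * r + t / \<delta> * g r))) \<le> K * \<tau> powr (- 1 / real l)) \<Longrightarrow>
      norm (osc_integral a g s \<delta> t x) \<le> C * \<delta> powr (- (s + 2)) * \<tau> powr (- 1 / real l)"
    using osc_integral_bound[OF c K l, of s] by blast
  have "norm (osc_integral a g s \<delta> t x) \<le> C * \<delta> powr (- (s + 2 - 1 / real l)) / \<bar>t\<bar> powr (1 / real l)"
    if t: "t \<noteq> 0" and \<delta>: "\<delta> > 0" for t \<delta> x
  proof -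
    have "norm (osc_integral a g s \<delta> t x) \<le> C * \<delta> powr (- (s + 2)) * \<bar>t / \<delta>\<bar> powr (- 1 / real l)"
      using t \<delta> by (intro bound cg osc) auto
    also have "\<dots> = C * \<delta> powr (- (s + 2 - 1 / real l)) / \<bar>t\<bar> powr (1 / real l)"
    proof -
      have "\<bar>t / \<delta>\<bar> powr (- 1 / real l) = \<delta> powr (1 / real l) / \<bar>t\<bar> powr (1 / real l)"
        using \<delta> t by (simp add: powr_minus powr_divide abs_divide divide_simps)
      moreover have "\<delta> powr (- (s + 2 - 1 / real l)) = \<delta> powr (- (s + 2)) * \<delta> powr (1 / real l)"
        by (simp flip: powr_add add: algebra_simps)
      ultimately show ?thesis by simp
    qed
    finally show ?thesis .
  qed
  then show ?thesis using C by blast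
qed

end

section \<open>Dyadic cutoffs\<close>

lemma smooth_derivative:
  fixes f :: "real \<Rightarrow> 'a::real_normed_vector"
  assumes "smooth f"
  obtains f' where "\<And>y. (f has_vector_derivative f' y) (at y)" "continuous_on UNIV f'"
proof -
  have "Cn_on (Suc 0) UNIV f" using assms by (simp add: smooth_def)
  then show ?thesis using that by auto
qed

lemma block_cutoff_support:
  assumes "block_cutoff P" "0 \<le> y" "y \<notin> {1/2..2}"
  shows "P y = 0"
proof (rule ccontr)
  assume "P y \<noteq> 0"
  then have "y \<in> closure {y. P y \<noteq> 0}" by (intro subsetD[OF closure_subset]) simp
  moreover have "closure {y. P y \<noteq> 0} \<subseteq> {-2..-1/2} \<union> {1/2..2}"
    using assms(1) unfolding block_cutoff_def by blast
  ultimately have "y \<in> {-2..-1/2} \<union> {1/2..2}" by (rule subsetD[rotated])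
  with assms(2,3) show False by simp
qed

text \<open>With \<open>e = 2 powi k\<close>, both terms of \<open>LP_Q\<close> are 1 below
  \<open>e / 2\<close> and both are 0 above \<open>2 * e\<close>. The radii \<open>3 * e / 5\<close>
  and \<open>8 * e / 5\<close> that the cutoff would allow are widened to the annulus of the
  blocks.\<close>

lemma LP_Q_support:
  assumes \<phi>: "LP_cutoff \<phi>" and y: "0 \<le> y" "y \<notin> {2 powi k / 2..2 * 2 powi k}"
  shows "LP_Q \<phi> k y = 0"
proof -
  have zero: "\<phi> z = 0" if "z > 4/5" for z
  proof (rule ccontr)
    assume "\<phi> z \<noteq> 0"
    then have "z \<in> closure {y. \<phi> y \<noteq> 0}" by (intro subsetD[OF closure_subset]) simp
    moreover have "closure {y. \<phi> y \<noteq> 0} \<subseteq> {-4/5..4/5}"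
      using \<phi> unfolding LP_cutoff_def by blast
    ultimately have "z \<in> {-4/5..4/5}" by (rule subsetD[rotated])
    with that show False by simp
  qed
  have one: "\<phi> z = 1" if "0 \<le> z" "z \<le> 3/5" for z
    using \<phi> that unfolding LP_cutoff_def by auto
  define e where "e = (2::real) powi k"
  have e: "e > 0" by (simp add: e_def)
  have "(2::real) powi (- k) = 1 / e"
    by (simp add: e_def power_int_minus divide_inverse)
  moreover have "(2::real) powi (- k - 1) = 1 / e / 2"
    using calculation by (simp add: power_int_diff)
  ultimately have Q: "LP_Q \<phi> k y = \<phi> (y / (2 * e)) - \<phi> (y / e)"
    by (simp add: LP_Q_def mult.commute)
  consider "y < e / 2" | "y > 2 * e" using y(2) by (fastforce simp: e_def)
  then show ?thesis
  proof cases
    case 1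
    then have "y / (2 * e) \<le> 3/5" "y / e \<le> 3/5" using e y by (auto simp: field_simps)
    then have "\<phi> (y / (2 * e)) = 1" "\<phi> (y / e) = 1" using e y(1) by (intro one; simp)+
    then show ?thesis by (simp add: Q)
  next
    case 2
    then have "y / (2 * e) > 4/5" "y / e > 4/5" using e y by (auto simp: field_simps)
    then show ?thesis using zero by (simp add: Q)
  qed
qed

lemma finite_dyadic_range:
  fixes y0 y1 :: real
  assumes "y0 > 0"
  shows "finite {k::int. y0 \<le> 2 powi k \<and> 2 powi k \<le> y1}"
proof -
  have "{k::int. y0 \<le> 2 powi k \<and> 2 powi k \<le> y1} \<subseteq> {\<lfloor>log 2 y0\<rfloor>..\<lceil>log 2 y1\<rceil>}"
  proof safe
    fix k :: int assume k: "y0 \<le> 2 powi k" "2 powi k \<le> y1"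
    have p: "(2::real) powi k = 2 powr of_int k" by (simp add: powr_real_of_int')
    have "log 2 y0 \<le> of_int k" using k(1) assms unfolding p by (simp add: log_le_iff)
    moreover have "of_int k \<le> log 2 y1"
      using k(2) less_le_trans[OF _ k(2), of 0] unfolding p by (simp add: le_log_iff)
    ultimately show "k \<in> {\<lfloor>log 2 y0\<rfloor>..\<lceil>log 2 y1\<rceil>}" by (auto simp: floor_le_iff le_ceiling_iff)
  qed
  then show ?thesis by (rule finite_subset) simp
qed

text \<open>Moves \<open>k\<close> from the cutoff into the phase: the amplitude becomes the fixed
  \<open>P\<close>, and the quotient of the new \<open>t\<close> and \<open>\<delta>\<close> is the
  old one.\<close>

lemma I_block_rescale:
  "I_block P g s \<delta> t x k = osc_integral P (\<lambda>r. g (2 powi k * r)) s (\<delta> / 2 powi k) (t / 2 powi k) x"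
  by (simp add: I_block_def osc_integral_def)

text \<open>The annulus of radii \<open>2 powi k / 2\<close> and \<open>2 * 2 powi k\<close> lies in
  \<open>{1/2 * y0..2 * y1}\<close>, where the derivatives are controlled. The constant may depend
  on \<open>k\<close>, of which there are finitely many.\<close>

lemma I_block_finite_type:
  assumes P: "block_cutoff P" and y: "0 < y0" "y0 \<le> 2 powi k" "2 powi k \<le> y1"
    and l: "l \<ge> 2" and lam: "lam > 0" and g: "Cn_on l {0<..} g"
    and low: "\<And>r. r \<in> {1/2 * y0..2 * y1} \<Longrightarrow> (\<Sum>p=1..l. \<bar>(deriv ^^ p) g r\<bar>) \<ge> lam"
  shows "\<exists>C\<ge>0. \<forall>t \<delta> x. t \<noteq> 0 \<longrightarrow> \<delta> > 0 \<longrightarrow>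
    norm (I_block P g s \<delta> t x k) \<le> C * \<delta> powr (- (s + 2 - 1 / real l)) / \<bar>t\<bar> powr (1 / real l)"
proof -
  define e where "e = (2::real) powi k"
  have e: "e > 0" by (simp add: e_def)
  obtain P' where P': "\<And>y. (P has_vector_derivative P' y) (at y)" "continuous_on UNIV P'"
    using P smooth_derivative unfolding block_cutoff_def by blast
  interpret annular_amplitude "\<lambda>y. P (y / e)" "\<lambda>y. (1 / e) *\<^sub>R P' (y / e)" "1/2 * y0" "2 * y1"
  proof
    show "((\<lambda>y. P (y / e)) has_vector_derivative (1 / e) *\<^sub>R P' (y / e)) (at y)" for y
    proof -
      have "((\<lambda>y. y / e) has_vector_derivative 1 / e) (at y)"
        using e by (auto intro!: derivative_eq_intros)
      from vector_diff_chain_at[OF this P'(1)] show ?thesis by (simp add: o_def)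
    qed
    show "continuous_on UNIV (\<lambda>y. (1 / e) *\<^sub>R P' (y / e))"
      using e by (intro continuous_intros continuous_on_compose2[OF P'(2)]) auto
    show "P (r / e) = 0" if "0 \<le> r" "r \<notin> {1/2 * y0..2 * y1}" for r
    proof (rule block_cutoff_support[OF P])
      show "r / e \<notin> {1/2..2}"
        using that(2) y e by (auto simp: e_def[symmetric] field_simps)
    qed (use that e in simp)
  qed (use y in simp)
  show ?thesis
    unfolding I_block_def e_def[symmetric]
    by (rule osc_integral_finite_type[OF _ l lam g low]) (use y in auto)
qed

text \<open>The sum of the cutoffs is itself one amplitude with a continuous derivative and support
  in \<open>{1/2 * y0..2 * y1}\<close> on the half-line, so it is treated as a whole.\<close>

lemma LP_sum_finite_type:
  assumes \<phi>: "LP_cutoff \<phi>" and y: "0 < y0" "y0 \<le> y1"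
    and l: "l \<ge> 2" and lam: "lam > 0" and g: "Cn_on l {0<..} g"
    and low: "\<And>r. r \<in> {1/2 * y0..2 * y1} \<Longrightarrow> (\<Sum>p=1..l. \<bar>(deriv ^^ p) g r\<bar>) \<ge> lam"
  shows "\<exists>C\<ge>0. \<forall>t \<delta> x. t \<noteq> 0 \<longrightarrow> \<delta> > 0 \<longrightarrow>
    norm (osc_integral (\<lambda>y. complex_of_real (\<Sum>k | y0 \<le> 2 powi k \<and> 2 powi k \<le> y1. LP_Q \<phi> k y)) g s \<delta> t x)
      \<le> C * \<delta> powr (- (s + 2 - 1 / real l)) / \<bar>t\<bar> powr (1 / real l)"
proof -
  obtain \<phi>' where \<phi>': "\<And>y. (\<phi> has_vector_derivative \<phi>' y) (at y)" "continuous_on UNIV \<phi>'"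
    using \<phi> smooth_derivative unfolding LP_cutoff_def by blast
  define Q' where "Q' k y = 2 powi (- k - 1) * \<phi>' (2 powi (- k - 1) * y) - 2 powi (- k) * \<phi>' (2 powi (- k) * y)"
    for k and y :: real
  define S where "S = {k::int. y0 \<le> 2 powi k \<and> 2 powi k \<le> y1}"
  interpret annular_amplitude "\<lambda>y. complex_of_real (\<Sum>k\<in>S. LP_Q \<phi> k y)" "\<lambda>y. complex_of_real (\<Sum>k\<in>S. Q' k y)"
    "1/2 * y0" "2 * y1"
  proof
    have dil: "((\<lambda>y. \<phi> (c * y)) has_real_derivative c * \<phi>' (c * y)) (at y)" for c y
    proof -
      have "((\<lambda>y. c * y) has_vector_derivative c) (at y)"
        by (auto intro!: derivative_eq_intros)
      from vector_diff_chain_at[OF this \<phi>'(1)] show ?thesis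
        by (simp add: o_def has_real_derivative_iff_has_vector_derivative)
    qed
    have "((\<lambda>y. \<Sum>k\<in>S. LP_Q \<phi> k y) has_real_derivative (\<Sum>k\<in>S. Q' k y)) (at y)" for y
      unfolding LP_Q_def Q'_def by (intro DERIV_sum DERIV_diff dil)
    then show "((\<lambda>y. complex_of_real (\<Sum>k\<in>S. LP_Q \<phi> k y)) has_vector_derivative of_real (\<Sum>k\<in>S. Q' k y)) (at y)" for y
      by (rule has_vector_derivative_of_real)
    show "continuous_on UNIV (\<lambda>y. complex_of_real (\<Sum>k\<in>S. Q' k y))"
      unfolding Q'_def by (intro continuous_intros continuous_on_compose2[OF \<phi>'(2)]) auto
    show "complex_of_real (\<Sum>k\<in>S. LP_Q \<phi> k r) = 0" if r: "0 \<le> r" "r \<notin> {1/2 * y0..2 * y1}" for r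
    proof -
      have "LP_Q \<phi> k r = 0" if "k \<in> S" for k
        using that r(2) by (intro LP_Q_support[OF \<phi> r(1)]) (auto simp: S_def)
      then show ?thesis by simp
    qed
  qed (use y in simp)
  show ?thesis
    unfolding S_def[symmetric]
    by (rule osc_integral_finite_type[OF _ l lam g low]) (use y in auto)
qed

text \<open>After the rescaling the amplitude no longer contains \<open>k\<close>, and
  \<open>2 powi k \<le> y0 / 2\<close> keeps the argument of \<open>g\<close> in
  \<open>{0<..y0}\<close> for radii up to 2. The linear term leaves the second derivative alone, so
  it does not affect the count of zeros.\<close>

lemma I_block_low_frequency:
  fixes g :: "real \<Rightarrow> real"
  assumes P: "block_cutoff P" and l: "l \<ge> 2" and lam: "lam > 0" and g: "Cn_on 2 {0<..} g"
    and low: "\<And>r. r \<in> {0<..y0} \<Longrightarrow> \<bar>deriv g r\<bar> \<ge> lam"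
    and fin: "finite {r\<in>{0<..y0}. (deriv ^^ 2) g r = 0}"
  shows "\<exists>C\<ge>0. \<forall>t \<delta> x. \<forall>k::int. t \<noteq> 0 \<longrightarrow> \<delta> > 0 \<longrightarrow> 2 powi k \<le> 1/2 * y0 \<longrightarrow>
    norm (I_block P g s \<delta> t x k)
      \<le> C * (2 powr ((s + 2 - 1 / real l) * of_int k) * \<delta> powr (- (s + 2 - 1 / real l))) / \<bar>t\<bar> powr (1 / real l)"
proof -
  obtain P' where P': "\<And>y. (P has_vector_derivative P' y) (at y)" "continuous_on UNIV P'"
    using P smooth_derivative unfolding block_cutoff_def by blast
  interpret annular_amplitude P P' "1/2" 2
    by unfold_locales (use P' block_cutoff_support[OF P] in auto)
  have g': "(g has_real_derivative deriv g x) (at x)"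
    and g'': "(deriv g has_real_derivative (deriv ^^ 2) g x) (at x)" if "x > 0" for x
    using Cn_on_imp_derivs[OF g, THEN conjunct1, rule_format, of 0 x]
      Cn_on_imp_derivs[OF g, THEN conjunct1, rule_format, of 1 x] that
    by (simp_all add: numeral_2_eq_2)
  have cg'': "continuous_on {0<..} ((deriv ^^ 2) g)"
    using Cn_on_imp_derivs[OF g] by simp
  have cg: "continuous_on {0<..} g"
    using g' by (intro DERIV_continuous_on) (auto intro: has_field_derivative_at_within)
  define Z where "Z = {r\<in>{0<..y0}. (deriv ^^ 2) g r = 0}"
  \<comment> \<open>\<open>4 * 2 ^ card Z\<close> divided by \<open>lam / 2\<close>: half of the
    lower bound on the derivative is given up to the linear term.\<close>
  define K where "K = 4 * 2 ^ card Z * 2 / lam"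
  have K: "K \<ge> 0" using lam by (simp add: K_def)
  obtain C where C: "C \<ge> 0" and bound:
    "\<And>g \<delta> t \<tau> x. \<delta> > 0 \<Longrightarrow> \<tau> > 0 \<Longrightarrow> continuous_on {0<..} g \<Longrightarrow>
      (\<And>\<mu> u v. 1 \<le> \<tau> \<Longrightarrow> \<bar>\<mu>\<bar> \<le> lam / 2 * \<tau> \<Longrightarrow> 1/2 \<le> u \<Longrightarrow> u \<le> v \<Longrightarrow> v \<le> 2 \<Longrightarrow>
        norm (integral {u..v} (\<lambda>r. cis (\<mu> * r + t / \<delta> * g r))) \<le> K * \<tau> powr (- 1 / real l)) \<Longrightarrow>
      norm (osc_integral P g s \<delta> t x) \<le> C * \<delta> powr (- (s + 2)) * \<tau> powr (- 1 / real l)"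
    using osc_integral_bound[OF half_gt_zero[OF lam] K l, of s] by blast
  have "norm (I_block P g s \<delta> t x k)
      \<le> C * (2 powr ((s + 2 - 1 / real l) * of_int k) * \<delta> powr (- (s + 2 - 1 / real l))) / \<bar>t\<bar> powr (1 / real l)"
    if t: "t \<noteq> 0" and \<delta>: "\<delta> > 0" and k: "2 powi k \<le> 1/2 * y0" for t \<delta> x and k :: int
  proof -
    define e where "e = (2::real) powi k"
    have e: "e > 0" "e \<le> 1/2 * y0" using k by (simp_all add: e_def)
    define T where "T = t / \<delta>"
    \<comment> \<open>The factor \<open>e\<close> comes from the chain rule: the rescaled phase has
      a derivative of size at least \<open>lam * \<tau>\<close>.\<close>
    define \<tau> where "\<tau> = e * \<bar>T\<bar>"
    have \<tau>: "\<tau> > 0" using e t \<delta> by (simp add: \<tau>_def T_def)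
    have T_eq: "t / e / (\<delta> / e) = T" using e by (simp add: T_def)
    have "norm (osc_integral P (\<lambda>r. g (e * r)) s (\<delta> / e) (t / e) x)
        \<le> C * (\<delta> / e) powr (- (s + 2)) * \<tau> powr (- 1 / real l)"
    proof (rule bound)
      show "\<delta> / e > 0" "\<tau> > 0" using \<delta> e \<tau> by auto
      show "continuous_on {0<..} (\<lambda>r. g (e * r))"
        using e by (intro continuous_on_compose2[OF cg] continuous_intros) auto
      fix \<mu> u v :: real assume \<tau>1: "1 \<le> \<tau>" and \<mu>: "\<bar>\<mu>\<bar> \<le> lam / 2 * \<tau>" and uv: "1/2 \<le> u" "u \<le> v" "v \<le> 2"
      have rng: "e * r \<in> {0<..y0}" if "r \<in> {u..v}" for r
      proof -
        have "e * r \<le> e * 2" using that uv e by (intro mult_left_mono) auto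
        then have "e * r \<le> y0" using e(2) by linarith
        moreover have "e * r > 0" using that uv e by (intro mult_pos_pos) auto
        ultimately show ?thesis by simp
      qed
      \<comment> \<open>In the rescaled variable the zeros sit at \<open>z / e\<close>; division by
        \<open>e\<close> is injective, so they still number \<open>card Z\<close>.\<close>
      have "norm (integral {u..v} (\<lambda>r. cis (\<mu> * r + T * g (e * r)))) \<le> 4 * 2 ^ card ((\<lambda>z. z / e) ` Z) / (lam / 2 * \<tau>)"
      proof (rule van_der_corput_first_finite[OF \<open>u \<le> v\<close>, where f' = "\<lambda>r. \<mu> + T * (e * deriv g (e * r))"
            and f'' = "\<lambda>r. T * (e * (e * (deriv ^^ 2) g (e * r)))"])
        fix r assume r: "r \<in> {u..v}"
        then have pos: "e * r > 0" using rng by auto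
        have lin: "((\<lambda>r. e * r) has_real_derivative e) (at r)" by (auto intro!: derivative_eq_intros)
        have 1: "((\<lambda>r. g (e * r)) has_real_derivative e * deriv g (e * r)) (at r within {u..v})"
          using DERIV_chain'[OF lin g'[OF pos]] by (simp add: mult.commute has_field_derivative_at_within)
        have 2: "((\<lambda>r. deriv g (e * r)) has_real_derivative e * (deriv ^^ 2) g (e * r)) (at r within {u..v})"
          using DERIV_chain'[OF lin g''[OF pos]] by (simp add: mult.commute has_field_derivative_at_within del: funpow.simps)
        show "((\<lambda>r. \<mu> * r + T * g (e * r)) has_real_derivative \<mu> + T * (e * deriv g (e * r))) (at r within {u..v})"
          by (auto intro!: derivative_eq_intros 1)
        show "((\<lambda>r. \<mu> + T * (e * deriv g (e * r))) has_real_derivative T * (e * (e * (deriv ^^ 2) g (e * r)))) (at r within {u..v})"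
          using DERIV_add[OF DERIV_const DERIV_cmult[OF DERIV_cmult[OF 2]]] by simp
        have "lam * \<tau> \<le> \<bar>deriv g (e * r)\<bar> * \<tau>"
          using low[OF rng[OF r]] \<tau> by (intro mult_right_mono) auto
        also have "\<dots> = \<bar>T * (e * deriv g (e * r))\<bar>"
          using e by (simp add: \<tau>_def abs_mult)
        finally show "lam / 2 * \<tau> \<le> \<bar>\<mu> + T * (e * deriv g (e * r))\<bar>"
          using \<mu> by linarith
      next
        have "continuous_on {u..v} (\<lambda>r. (deriv ^^ 2) g (e * r))"
          using rng by (intro continuous_on_compose2[OF cg''] continuous_intros) auto
        then show "continuous_on {u..v} (\<lambda>r. T * (e * (e * (deriv ^^ 2) g (e * r))))"
          by (intro continuous_intros)
        show "lam / 2 * \<tau> > 0" using lam \<tau> by simp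
        show "finite ((\<lambda>z. z / e) ` Z)" using fin by (simp add: Z_def)
        fix r assume r: "r \<in> {u<..<v}" and "T * (e * (e * (deriv ^^ 2) g (e * r))) = 0"
        then have "(deriv ^^ 2) g (e * r) = 0" using e t \<delta> by (auto simp: T_def)
        then have "e * r \<in> Z" using rng[of r] r by (auto simp: Z_def)
        then show "r \<in> (\<lambda>z. z / e) ` Z" using e by (intro image_eqI[of _ _ "e * r"]) auto
      qed
      also have "card ((\<lambda>z. z / e) ` Z) = card Z"
        using e by (intro card_image inj_onI) auto
      also have "4 * 2 ^ card Z / (lam / 2 * \<tau>) = K * (1 / \<tau>)"
        using lam \<tau> by (simp add: K_def field_simps)
      also have "1 / \<tau> = \<tau> powr (- 1)" using \<tau> by (simp add: powr_minus_divide)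
      \<comment> \<open>Decay of first order is more than what is claimed;
        \<open>\<tau> \<ge> 1\<close> allows the weaker exponent.\<close>
      also have "K * \<tau> powr (- 1) \<le> K * \<tau> powr (- 1 / real l)"
        using \<tau>1 l K by (intro mult_left_mono powr_mono) (auto simp: field_simps)
      finally show "norm (integral {u..v} (\<lambda>r. cis (\<mu> * r + t / e / (\<delta> / e) * g (e * r)))) \<le> K * \<tau> powr (- 1 / real l)"
        unfolding T_eq .
    qed
    also have "\<dots> = C * (2 powr ((s + 2 - 1 / real l) * of_int k) * \<delta> powr (- (s + 2 - 1 / real l))) / \<bar>t\<bar> powr (1 / real l)"
    proof -
      \<comment> \<open>The prefactor contributes \<open>e powr (s + 2)\<close> and the power of
        \<open>\<tau>\<close> contributes \<open>e powr (- (1 / l))\<close>; together they form the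
        claimed power of \<open>2^k\<close>.\<close>
      have e2: "e = 2 powr of_int k" by (simp add: e_def powr_real_of_int')
      have a: "\<delta> powr (- (s + 2 - 1 / real l)) = \<delta> powr (- (s + 2)) * \<delta> powr (1 / real l)"
        by (simp flip: powr_add add: algebra_simps)
      have b: "2 powr ((s + 2 - 1 / real l) * of_int k) = e powr (s + 2) * e powr (- (1 / real l))"
        by (simp add: e2 powr_powr flip: powr_add) (simp add: algebra_simps)
      have c: "(\<delta> / e) powr (- (s + 2)) = \<delta> powr (- (s + 2)) * e powr (s + 2)"
        using powr_minus_divide[of e "s + 2"] by (simp add: powr_divide)
      have d: "\<tau> powr (- 1 / real l) = e powr (- (1 / real l)) * \<delta> powr (1 / real l) / \<bar>t\<bar> powr (1 / real l)"
        using \<delta> by (simp add: \<tau>_def T_def powr_mult powr_divide powr_minus abs_divide divide_simps)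
      show ?thesis unfolding a b c d by simp
    qed
    finally show ?thesis by (simp add: I_block_rescale e_def)
  qed
  then show ?thesis using C by blast
qed

text \<open>The suprema are formed in \<open>ereal\<close>, where they exist unconditionally, so
  each inequality also asserts that they are finite.\<close>

theorem lemma2p21:
  fixes lam s y0 y1 :: real and l :: nat
    and g :: "real \<Rightarrow> real" and P :: "real \<Rightarrow> complex" and \<phi>0 :: "real \<Rightarrow> real"
  assumes "lam > 0" and "y1 \<ge> y0" and "y0 > 0" and "l \<ge> 2"
    and "Cn_on 2 {0<..} g"
    and "block_cutoff P" and "LP_cutoff \<phi>0"
  shows
    "((\<forall>r\<in>{0<..y0}. \<bar>deriv g r\<bar> \<ge> lam) \<and> finite {r\<in>{0<..y0}. (deriv ^^ 2) g r = 0} \<longrightarrow>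
       (\<exists>C>0. \<forall>t \<delta>. \<forall>k::int. t \<noteq> 0 \<longrightarrow> \<delta> > 0 \<longrightarrow> 2 powi k \<le> 1/2 * y0 \<longrightarrow>
          (SUP x. ereal (norm (I_block P g s \<delta> t x k)))
            \<le> ereal (C * (2 powr ((s + 2 - 1 / real l) * of_int k) * \<delta> powr (- (s + 2 - 1 / real l)))
                       / \<bar>t\<bar> powr (1 / real l))))
     \<and>
     (Cn_on l {0<..} g \<and> (\<forall>r\<in>{1/2 * y0..2 * y1}. (\<Sum>p=1..l. \<bar>(deriv ^^ p) g r\<bar>) \<ge> lam)
        \<and> finite {r\<in>{1/2 * y0..2 * y1}. (deriv ^^ 2) g r = 0} \<longrightarrow>
       (\<exists>C>0. \<forall>t \<delta>. t \<noteq> 0 \<longrightarrow> \<delta> > 0 \<longrightarrow>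
          (\<forall>k::int. y0 \<le> 2 powi k \<longrightarrow> 2 powi k \<le> y1 \<longrightarrow>
             (SUP x. ereal (norm (I_block P g s \<delta> t x k)))
               \<le> ereal (C * \<delta> powr (- (s + 2 - 1 / real l)) / \<bar>t\<bar> powr (1 / real l)))
          \<and> (SUP x. ereal (norm (osc_integral
                 (\<lambda>y. complex_of_real (\<Sum>k | y0 \<le> 2 powi k \<and> 2 powi k \<le> y1. LP_Q \<phi>0 k y)) g s \<delta> t x)))
               \<le> ereal (C * \<delta> powr (- (s + 2 - 1 / real l)) / \<bar>t\<bar> powr (1 / real l))))"
proof (intro conjI impI)
  assume hyp: "(\<forall>r\<in>{0<..y0}. \<bar>deriv g r\<bar> \<ge> lam) \<and> finite {r\<in>{0<..y0}. (deriv ^^ 2) g r = 0}"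
  obtain C where C: "C \<ge> 0" and bound: "\<And>t \<delta> x. \<And>k::int. t \<noteq> 0 \<Longrightarrow> \<delta> > 0 \<Longrightarrow> 2 powi k \<le> 1/2 * y0 \<Longrightarrow>
    norm (I_block P g s \<delta> t x k)
      \<le> C * (2 powr ((s + 2 - 1 / real l) * of_int k) * \<delta> powr (- (s + 2 - 1 / real l))) / \<bar>t\<bar> powr (1 / real l)"
    using I_block_low_frequency[OF assms(6,4,1,5), of y0 s] hyp by blast
  show "\<exists>C>0. \<forall>t \<delta>. \<forall>k::int. t \<noteq> 0 \<longrightarrow> \<delta> > 0 \<longrightarrow> 2 powi k \<le> 1/2 * y0 \<longrightarrow>
          (SUP x. ereal (norm (I_block P g s \<delta> t x k)))
            \<le> ereal (C * (2 powr ((s + 2 - 1 / real l) * of_int k) * \<delta> powr (- (s + 2 - 1 / real l)))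
                       / \<bar>t\<bar> powr (1 / real l))"
  \<comment> \<open>So far \<open>C\<close> is only nonnegative, and a positive constant is
    claimed.\<close>
  proof (intro exI[of _ "C + 1"] conjI allI impI SUP_least)
    fix t \<delta> :: real and k :: int and x
    assume "t \<noteq> 0" "\<delta> > 0" "2 powi k \<le> 1/2 * y0"
    then have "norm (I_block P g s \<delta> t x k)
      \<le> C * (2 powr ((s + 2 - 1 / real l) * of_int k) * \<delta> powr (- (s + 2 - 1 / real l))) / \<bar>t\<bar> powr (1 / real l)"
      by (rule bound)
    also have "\<dots> \<le> (C + 1) * (2 powr ((s + 2 - 1 / real l) * of_int k) * \<delta> powr (- (s + 2 - 1 / real l))) / \<bar>t\<bar> powr (1 / real l)"
      by (intro divide_right_mono mult_right_mono) auto
    finally show "ereal (norm (I_block P g s \<delta> t x k)) \<le> ereal \<dots>"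
      by simp
  qed (use C in simp)
next
  assume hyp: "Cn_on l {0<..} g \<and> (\<forall>r\<in>{1/2 * y0..2 * y1}. (\<Sum>p=1..l. \<bar>(deriv ^^ p) g r\<bar>) \<ge> lam)
        \<and> finite {r\<in>{1/2 * y0..2 * y1}. (deriv ^^ 2) g r = 0}"
  then have low: "\<And>r. r \<in> {1/2 * y0..2 * y1} \<Longrightarrow> (\<Sum>p=1..l. \<bar>(deriv ^^ p) g r\<bar>) \<ge> lam" by blast
  define S where "S = {k::int. y0 \<le> 2 powi k \<and> 2 powi k \<le> y1}"
  have fin: "finite S" unfolding S_def by (rule finite_dyadic_range) fact
  define L where "L t \<delta> = \<delta> powr (- (s + 2 - 1 / real l)) / \<bar>t\<bar> powr (1 / real l)" for t \<delta> :: real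
  have L: "L t \<delta> \<ge> 0" for t \<delta> by (simp add: L_def)
  have "\<forall>k\<in>S. \<exists>C\<ge>0. \<forall>t \<delta> x. t \<noteq> 0 \<longrightarrow> \<delta> > 0 \<longrightarrow> norm (I_block P g s \<delta> t x k) \<le> C * L t \<delta>"
  proof
    fix k assume "k \<in> S"
    then have "y0 \<le> 2 powi k" "2 powi k \<le> y1" by (simp_all add: S_def)
    from I_block_finite_type[OF assms(6,3) this assms(4,1) hyp[THEN conjunct1] low, of s]
    show "\<exists>C\<ge>0. \<forall>t \<delta> x. t \<noteq> 0 \<longrightarrow> \<delta> > 0 \<longrightarrow> norm (I_block P g s \<delta> t x k) \<le> C * L t \<delta>"
      unfolding L_def times_divide_eq_right by simp
  qed
  then obtain c where c: "\<And>k. k \<in> S \<Longrightarrow> c k \<ge> 0"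
    "\<And>k t \<delta> x. k \<in> S \<Longrightarrow> t \<noteq> 0 \<Longrightarrow> \<delta> > 0 \<Longrightarrow> norm (I_block P g s \<delta> t x k) \<le> c k * L t \<delta>"
    by metis
  obtain C where C: "C \<ge> 0" "\<And>t \<delta> x. t \<noteq> 0 \<Longrightarrow> \<delta> > 0 \<Longrightarrow>
    norm (osc_integral (\<lambda>y. complex_of_real (\<Sum>k | y0 \<le> 2 powi k \<and> 2 powi k \<le> y1. LP_Q \<phi>0 k y)) g s \<delta> t x)
      \<le> C * L t \<delta>"
    using LP_sum_finite_type[OF assms(7,3,2,4,1) hyp[THEN conjunct1] low, of s]
    unfolding L_def times_divide_eq_right by blast
  \<comment> \<open>\<open>S\<close> is finite, so the constants of the blocks can be added up. A
    single \<open>D\<close> serves every \<open>k\<close> and the summed cutoff; the summand 1 makes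
    it positive.\<close>
  define D where "D = 1 + C + (\<Sum>k\<in>S. c k)"
  have sum: "(\<Sum>k\<in>S. c k) \<ge> 0" using c(1) by (rule sum_nonneg)
  have D: "D > 0" "C \<le> D" using C sum by (simp_all add: D_def)
  have cD: "c k \<le> D" if "k \<in> S" for k
    using member_le_sum[OF that, of c] c(1) fin C by (simp add: D_def)
  show "\<exists>C>0. \<forall>t \<delta>. t \<noteq> 0 \<longrightarrow> \<delta> > 0 \<longrightarrow>
          (\<forall>k::int. y0 \<le> 2 powi k \<longrightarrow> 2 powi k \<le> y1 \<longrightarrow>
             (SUP x. ereal (norm (I_block P g s \<delta> t x k)))
               \<le> ereal (C * \<delta> powr (- (s + 2 - 1 / real l)) / \<bar>t\<bar> powr (1 / real l)))
          \<and> (SUP x. ereal (norm (osc_integral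
                 (\<lambda>y. complex_of_real (\<Sum>k | y0 \<le> 2 powi k \<and> 2 powi k \<le> y1. LP_Q \<phi>0 k y)) g s \<delta> t x)))
               \<le> ereal (C * \<delta> powr (- (s + 2 - 1 / real l)) / \<bar>t\<bar> powr (1 / real l))"
    unfolding times_divide_eq_right[symmetric] L_def[symmetric]
  proof (intro exI[of _ D] conjI allI impI SUP_least)
    fix t \<delta> :: real and x assume t: "t \<noteq> 0" and \<delta>: "\<delta> > 0"
    show "ereal (norm (I_block P g s \<delta> t x k)) \<le> ereal (D * L t \<delta>)"
      if "y0 \<le> 2 powi k" "2 powi k \<le> y1" for k :: int
    proof -
      have k: "k \<in> S" using that by (simp add: S_def)
      show ?thesis
        using order_trans[OF c(2)[OF k t \<delta>] mult_right_mono[OF cD[OF k] L]] by simp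
    qed
    show "ereal (norm (osc_integral (\<lambda>y. complex_of_real (\<Sum>k | y0 \<le> 2 powi k \<and> 2 powi k \<le> y1. LP_Q \<phi>0 k y)) g s \<delta> t x))
        \<le> ereal (D * L t \<delta>)"
      using order_trans[OF C(2)[OF t \<delta>] mult_right_mono[OF D(2) L]] by simp
  qed (use D in simp)
qed

end
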